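(* Let $Q\in \mathrm{GL}(\mathbb{R}^2)$, $K\in\mathbb{N}$, let the points $z_K^p\in T_K(p)$ ($p\in\Lambda^Q$) be chosen arbitrarily, let $P^Q(K)=\{z_K^p : p\in\Lambda^Q\}\cap I^2$ and $N=\#P^Q(K)$ (with $N\geq 1$). Then $$\mathcal{D}\big(L(P^Q(K))\big)\ \leq\ \frac{\|Q\|_F}{\sqrt{|\det(Q)|}}\,\frac{8+3\sqrt{2}}{\sqrt{N}}+O(N^{-1}),$$ where the implied constant in $O(N^{-1})$ depends only on $Q$ (not on $K$ or on the choice of the points $z_K^p$).
   Context: $\mathbb{S}^2\subset\mathbb{R}^3$ is the unit sphere, $\sigma$ its normalized surface measure. For $w\in\mathbb{S}^2$ and $t\in[-1,1]$, $C(w,t)=\{x\in\mathbb{S}^2 : \langle w,x\rangle\geq t\}$. For a finite set $P_N=\{p_1,\dots,p_N\}\subset\mathbb{S}^2$ of $N$ points, the spherical cap discrepancy is $$\mathcal{D}(P_N)=\sup_{w\in\mathbb{S}^2}\sup_{-1\leq t\leq 1}\Big|\frac1N\sum_{j=1}^N\chi_{C(w,t)}(p_j)-\sigma(C(w,t))\Big|.$$ $I^2=[0,1)\times(0,1)$, and $\mathbb{S}^2_p$ is $\mathbb{S}^2$ with the poles $(0,0,\pm1)$ removed. The Lambert map is the (area preserving) bijection $L:I^2\to\mathbb{S}^2_p$, $$L(x,y)=\big(2\sqrt{y-y^2}\cos(2\pi x),\,2\sqrt{y-y^2}\sin(2\pi x),\,1-2y\big).$$ For $Q\in\mathrm{GL}(\mathbb{R}^2)$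 (invertible $2\times2$ real matrices): $\Lambda^Q=Q\mathbb{Z}^2$, $\Omega^Q=Q[0,1)^2$, and for $K\in\mathbb{N}$, $p\in\Lambda^Q$: $T_K(p)=\frac1K(p+\Omega^Q)$; these sets tile $\mathbb{R}^2$. $\|Q\|_F=\sqrt{\mathrm{trace}(Q^tQ)}$ is the Frobenius norm. *)

theory Defs
  imports "HOL-Probability.Probability"
begin

section \<open>Spherical cap discrepancy\<close>

text \<open>
  The normalized surface measure of the unit sphere, by radial projection of Lebesgue measure: a
  Borel set \<open>A\<close> of the sphere gets the volume of the solid cone
  \<open>{r x. 0 \<le> r \<le> 1, x \<in> A}\<close> divided by the volume of the unit ball. (The centre, where
  \<open>sgn 0 = 0\<close>, is a null set.) The lemmas below show that it is a rotation invariant Borel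
  probability measure living on the sphere, properties that determine it uniquely.
\<close>

definition sphere_measure :: "(real^3) measure" where
  "sphere_measure = distr (uniform_measure lborel (cball 0 1)) borel sgn"

definition cap :: "real^3 \<Rightarrow> real \<Rightarrow> (real^3) set" where
  "cap w t = {x \<in> sphere 0 1. w \<bullet> x \<ge> t}"

definition cap_discrepancy :: "(real^3) set \<Rightarrow> real" where
  "cap_discrepancy P =
     (SUP w \<in> sphere 0 1. SUP t \<in> {-1..1}.
        \<bar>1 / real (card P) * (\<Sum>p\<in>P. indicator (cap w t) p) - measure sphere_measure (cap w t)\<bar>)"

lemma emeasure_unit_cball_pos_finite:
  "emeasure lborel (cball 0 1 :: (real^3) set) \<noteq> 0"
  "emeasure lborel (cball 0 1 :: (real^3) set) \<noteq> \<infinity>"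
proof -
  have "emeasure lborel (ball 0 1 :: (real^3) set) \<noteq> 0"
    by (simp add: emeasure_lborel_ball_finite emeasure_ball unit_ball_vol_pos less_imp_neq [symmetric])
  moreover have "emeasure lborel (ball 0 1 :: (real^3) set) \<le> emeasure lborel (cball 0 1 :: (real^3) set)"
    by (intro emeasure_mono) auto
  ultimately show "emeasure lborel (cball 0 1 :: (real^3) set) \<noteq> 0"
    by auto
  show "emeasure lborel (cball 0 1 :: (real^3) set) \<noteq> \<infinity>"
    using emeasure_lborel_cball_finite[of "0::real^3" 1] by simp
qed

lemma sets_sphere_measure [measurable_cong, simp]: "sets sphere_measure = sets borel"
  by (simp add: sphere_measure_def)

lemma emeasure_sphere_measure:
  assumes A: "A \<in> sets borel"
  shows "emeasure sphere_measure A =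
    emeasure lborel {x \<in> cball 0 1. sgn x \<in> A} / emeasure lborel (cball 0 1 :: (real^3) set)"
proof -
  have S: "(sgn :: real^3 \<Rightarrow> real^3) -` A \<in> sets borel"
    using measurable_sets[OF borel_measurable_sgn A] by simp
  have "emeasure sphere_measure A = emeasure (uniform_measure lborel (cball 0 1)) (sgn -` A)"
    using A by (simp add: sphere_measure_def emeasure_distr)
  also have "\<dots> = emeasure lborel (cball 0 1 \<inter> sgn -` A) / emeasure lborel (cball 0 1 :: (real^3) set)"
    using S by (intro emeasure_uniform_measure) auto
  also have "cball 0 1 \<inter> sgn -` A = {x \<in> cball 0 1. sgn x \<in> A}"
    by auto
  finally show ?thesis .
qed

lemma prob_space_sphere_measure: "prob_space sphere_measure"
  unfolding sphere_measure_def
  using emeasure_unit_cball_pos_finite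
  by (intro prob_space.prob_space_distr prob_space_uniform_measure) auto

lemma sphere_measure_sphere: "emeasure sphere_measure (sphere 0 1) = 1"
proof -
  have "{x \<in> cball 0 1. sgn x \<in> sphere 0 (1::real)} = cball 0 1 - {0 :: real^3}"
    by (auto simp: norm_sgn)
  moreover have "emeasure lborel (cball 0 1 - {0 :: real^3}) = emeasure lborel (cball 0 1 :: (real^3) set)"
    by (subst emeasure_Diff) auto
  ultimately show ?thesis
    using emeasure_unit_cball_pos_finite
    by (simp add: emeasure_sphere_measure ennreal_divide_self top.not_eq_extremum)
qed

lemma sphere_measure_invariant:
  assumes f: "orthogonal_transformation f"
  shows "distr sphere_measure borel f = sphere_measure"
proof (rule measure_eqI)
  show "sets (distr sphere_measure borel f) = sets sphere_measure" by simp
next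
  fix A assume "A \<in> sets (distr sphere_measure borel f)"
  then have A: "A \<in> sets borel" by simp
  have lin: "linear f" using f by (rule orthogonal_transformation_linear)
  have nrm: "norm (f x) = norm x" for x using f by (rule orthogonal_transformation_norm)
  have bm [measurable]: "f \<in> borel_measurable borel"
    using lin by (intro borel_measurable_continuous_onI linear_continuous_on) (simp add: linear_conv_bounded_linear)
  have fA: "f -` A \<in> sets borel"
    using measurable_sets[OF bm A] by simp
  have sgnf: "sgn (f x) = f (sgn x)" for x
    by (simp add: sgn_div_norm nrm linear_cmul[OF lin])
  define S where "S = {x \<in> cball 0 1. sgn x \<in> f -` A}"
  have cone: "{x \<in> cball 0 1. sgn x \<in> B} \<in> sets borel" if "B \<in> sets borel" for B :: "(real^3) set"
  proof -
    have "(sgn :: real^3 \<Rightarrow> real^3) -` B \<in> sets borel"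
      using measurable_sets[OF borel_measurable_sgn that] by simp
    moreover have "{x \<in> cball 0 1. sgn x \<in> B} = cball 0 1 \<inter> sgn -` B" by auto
    ultimately show ?thesis by auto
  qed
  have Sb: "S \<in> sets borel" unfolding S_def by (rule cone[OF fA])
  have Sf: "S \<in> lmeasurable"
    using Sb by (intro bounded_set_imp_lmeasurable bounded_subset[OF bounded_cball[of 0 1]])
      (auto simp: S_def)
  have img: "f ` S = {x \<in> cball 0 1. sgn x \<in> A}"
  proof
    show "f ` S \<subseteq> {x \<in> cball 0 1. sgn x \<in> A}"
      by (auto simp: S_def nrm sgnf)
    show "{x \<in> cball 0 1. sgn x \<in> A} \<subseteq> f ` S"
    proof
      fix y assume y: "y \<in> {x \<in> cball 0 1. sgn x \<in> A}"
      obtain x where x: "y = f x"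
        using orthogonal_transformation_surj[OF f] by (metis surjE)
      have "x \<in> S" using y unfolding x S_def by (simp add: nrm sgnf)
      then show "y \<in> f ` S" using x by blast
    qed
  qed
  have "emeasure lborel (f ` S) = emeasure lborel S"
  proof -
    have "emeasure lebesgue (f ` S) = emeasure lebesgue S"
      using measure_orthogonal_image[OF f Sf] measurable_orthogonal_image[OF f Sf] Sf
      by (simp add: emeasure_eq_measure2)
    then show ?thesis
      using Sb cone[OF A] by (simp add: img)
  qed
  then have "emeasure sphere_measure (f -` A) = emeasure sphere_measure A"
    unfolding emeasure_sphere_measure[OF A] emeasure_sphere_measure[OF fA]
    by (simp only: img flip: S_def)
  moreover have "space sphere_measure = UNIV"
    by (simp add: sphere_measure_def)
  ultimately show "emeasure (distr sphere_measure borel f) A = emeasure sphere_measure A"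
    using A by (subst emeasure_distr) auto
qed


section \<open>The Lambert map and perturbed lattices\<close>

definition unit_square :: "(real^2) set" where
  "unit_square = {v. 0 \<le> v$1 \<and> v$1 < 1 \<and> 0 < v$2 \<and> v$2 < 1}"

definition lambert :: "real^2 \<Rightarrow> real^3" where
  "lambert v = (let x = v$1; y = v$2 in
     vector [2 * sqrt (y - y\<^sup>2) * cos (2 * pi * x), 2 * sqrt (y - y\<^sup>2) * sin (2 * pi * x), 1 - 2 * y])"

definition lattice :: "real^2^2 \<Rightarrow> (real^2) set" where
  "lattice Q = (\<lambda>m. Q *v m) ` {m. \<forall>i. m$i \<in> \<int>}"

definition fundamental_domain :: "real^2^2 \<Rightarrow> (real^2) set" where
  "fundamental_domain Q = (\<lambda>v. Q *v v) ` {v. \<forall>i. 0 \<le> v$i \<and> v$i < 1}"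

definition tile :: "real^2^2 \<Rightarrow> nat \<Rightarrow> real^2 \<Rightarrow> (real^2) set" where
  "tile Q K p = (\<lambda>u. (1 / real K) *\<^sub>R (p + u)) ` fundamental_domain Q"

definition frobenius_norm :: "real^2^2 \<Rightarrow> real" where
  "frobenius_norm Q = sqrt (trace (transpose Q ** Q))"

definition perturbed_lattice_points :: "real^2^2 \<Rightarrow> (real^2 \<Rightarrow> real^2) \<Rightarrow> (real^2) set" where
  "perturbed_lattice_points Q z = z ` lattice Q \<inter> unit_square"

end

theory Submission
  imports Defs
begin

text \<open>
  A tile is contained in a box of size \<open>a \<times> b\<close>, where \<open>K a\<close> and \<open>K b\<close> are the absolute row sums
  of \<open>Q\<close>, and has area \<open>|det Q| / K\<^sup>2\<close>. So the number of sample points in a set is at most the area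
  of the set thickened by such a box, divided by the area of a tile. The preimage of a cap under the
  Lambert map meets every horizontal and every vertical line in at most two segments; thickening it
  therefore adds at most \<open>4 a + 4 b + 8 a b\<close> to its area. Comparing \<open>N\<close> with \<open>K\<^sup>2 / |det Q|\<close> costs
  another \<open>2 a + 2 b\<close>, and \<open>6 (a + b) \<le> 12 \<parallel>Q\<parallel>\<^sub>F / K\<close> by Cauchy--Schwarz, where
  \<open>12 \<le> 8 + 3 sqrt 2\<close>. Lower bounds on the number of points in a cap come from the upper bound for the
  complementary cap.
\<close>

section \<open>Thickened caps in the Lambert square\<close>

text \<open>The segments produced below come from cutting a set at one point, so they may share that
  point; a finite overlap is null and lets the lengths add. Either segment may be empty.\<close>

definition two_arcs :: "real set \<Rightarrow> bool" where
  "two_arcs S \<longleftrightarrow> (\<exists>I J. S = I \<union> J \<and> compact I \<and> connected I \<and> compact J \<and> connected J \<and> finite (I \<inter> J))"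

lemma emeasure_thicken_interval:
  fixes I :: "real set"
  assumes I: "compact I" "connected I" and e: "0 \<le> e"
  shows "emeasure lborel {x. \<exists>y\<in>I. \<bar>x - y\<bar> \<le> e} \<le> emeasure lborel I + ennreal (2 * e)"
    and "{x. \<exists>y\<in>I. \<bar>x - y\<bar> \<le> e} \<in> sets borel"
proof -
  obtain p q where pq: "I = {p..q}"
    using I connected_compact_interval_1 by metis
  have "emeasure lborel {x. \<exists>y\<in>I. \<bar>x - y\<bar> \<le> e} \<le> emeasure lborel I + ennreal (2 * e) \<and>
    {x. \<exists>y\<in>I. \<bar>x - y\<bar> \<le> e} \<in> sets borel"
  proof (cases "p \<le> q")
    case True
    have "{x. \<exists>y\<in>I. \<bar>x - y\<bar> \<le> e} = {p - e..q + e}"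
    proof (intro set_eqI iffI)
      \<comment> \<open>The witness \<open>max p (min q x)\<close> is the point of the interval
        nearest to \<open>x\<close>.\<close>
      fix x assume "x \<in> {p - e..q + e}"
      then show "x \<in> {x. \<exists>y\<in>I. \<bar>x - y\<bar> \<le> e}"
        using True e unfolding pq by (intro CollectI bexI[of _ "max p (min q x)"]) auto
    qed (auto simp: pq)
    then show ?thesis
      using True e unfolding pq by (simp add: ennreal_plus[symmetric] del: ennreal_plus)
  qed (auto simp: pq)
  then show "emeasure lborel {x. \<exists>y\<in>I. \<bar>x - y\<bar> \<le> e} \<le> emeasure lborel I + ennreal (2 * e)"
    and "{x. \<exists>y\<in>I. \<bar>x - y\<bar> \<le> e} \<in> sets borel" by auto
qed

text \<open>Two segments have at most four ends, and each end moves outward by \<open>e\<close>.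
  Overlaps of the thickened segments are absorbed by subadditivity.\<close>

lemma emeasure_thicken_two_arcs:
  assumes S: "two_arcs S" and e: "0 \<le> e"
  shows "emeasure lborel {x. \<exists>y\<in>S. \<bar>x - y\<bar> \<le> e} \<le> emeasure lborel S + ennreal (4 * e)"
proof -
  obtain I J where IJ: "S = I \<union> J" "compact I" "connected I" "compact J" "connected J" "finite (I \<inter> J)"
    using S unfolding two_arcs_def by blast
  note mI = emeasure_thicken_interval[OF IJ(2,3) e] and mJ = emeasure_thicken_interval[OF IJ(4,5) e]
  have bI: "I \<in> sets lborel" "J \<in> sets lborel"
    using IJ by (auto simp: borel_compact)
  have "emeasure lborel {x. \<exists>y\<in>S. \<bar>x - y\<bar> \<le> e} =
      emeasure lborel ({x. \<exists>y\<in>I. \<bar>x - y\<bar> \<le> e} \<union> {x. \<exists>y\<in>J. \<bar>x - y\<bar> \<le> e})"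
    unfolding IJ(1) by (intro arg_cong[of _ _ "emeasure lborel"]) auto
  also have "\<dots> \<le> emeasure lborel {x. \<exists>y\<in>I. \<bar>x - y\<bar> \<le> e} + emeasure lborel {x. \<exists>y\<in>J. \<bar>x - y\<bar> \<le> e}"
    using mI mJ by (intro emeasure_subadditive) auto
  also have "\<dots> \<le> (emeasure lborel I + ennreal (2 * e)) + (emeasure lborel J + ennreal (2 * e))"
    using mI mJ by (intro add_mono) auto
  also have "\<dots> = (emeasure lborel I + emeasure lborel J) + (ennreal (2 * e) + ennreal (2 * e))"
    by (simp add: ac_simps)
  also have "ennreal (2 * e) + ennreal (2 * e) = ennreal (4 * e)"
    using e by (simp add: ennreal_plus[symmetric] del: ennreal_plus)
  \<comment> \<open>Equality holds because the overlap of the two segments is finite, hence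
    null.\<close>
  also have "emeasure lborel I + emeasure lborel J = emeasure lborel S"
  proof -
    have "emeasure lborel J \<le> emeasure lborel ((J - I) \<union> (I \<inter> J))"
      using bI by (intro emeasure_mono) auto
    also have "\<dots> \<le> emeasure lborel (J - I) + emeasure lborel (I \<inter> J)"
      using bI by (intro emeasure_subadditive) auto
    also have "emeasure lborel (I \<inter> J) = 0"
      using IJ(6) by (simp add: emeasure_lborel_countable uncountable_infinite countable_finite)
    finally have "emeasure lborel J \<le> emeasure lborel (J - I)" by simp
    moreover have "emeasure lborel (J - I) \<le> emeasure lborel J"
      using bI by (intro emeasure_mono) auto
    ultimately have J: "emeasure lborel J = emeasure lborel (J - I)" by simp
    have "emeasure lborel I + emeasure lborel (J - I) = emeasure lborel (I \<union> (J - I))"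
      using bI by (intro plus_emeasure) auto
    then show ?thesis unfolding J IJ(1) by simp
  qed
  finally show ?thesis .
qed

text \<open>Injectivity makes the overlap of the image segments the image of the overlap, so it
  stays finite.\<close>

lemma two_arcs_image:
  assumes S: "two_arcs S" and g: "continuous_on S g" "inj_on g S"
  shows "two_arcs (g ` S)"
proof -
  obtain I J where IJ: "S = I \<union> J" "compact I" "connected I" "compact J" "connected J" "finite (I \<inter> J)"
    using S unfolding two_arcs_def by blast
  have "g ` I \<inter> g ` J = g ` (I \<inter> J)"
    using g(2) unfolding IJ(1) by (subst inj_on_image_Int[of g S]) (auto simp: IJ(1))
  moreover have "continuous_on I g" "continuous_on J g"
    using g(1) unfolding IJ(1) by (auto intro: continuous_on_subset)
  ultimately show ?thesis
    unfolding two_arcs_def using IJ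
    by (intro exI[of _ "g ` I"] exI[of _ "g ` J"])
       (auto intro!: compact_continuous_image connected_continuous_image simp: image_Un)
qed

text \<open>Cosine falls on [0, pi] and rises on [pi, 2 pi], so on a subinterval it is largest at an
  end. This quasiconvexity makes its sublevel sets intervals.\<close>

lemma cos_le_max_0_2pi:
  assumes "0 \<le> u1" "u1 \<le> u" "u \<le> u2" "u2 \<le> 2 * pi"
  shows "cos u \<le> max (cos u1) (cos u2)"
proof (cases "u \<le> pi")
  case True
  then have "cos u \<le> cos u1"
    using assms by (intro cos_monotone_0_pi_le) auto
  then show ?thesis by simp
next
  case False
  \<comment> \<open>Reflection at pi moves the rising branch onto the falling one.\<close>
  have "cos (2 * pi - u) \<le> cos (2 * pi - u2)"
    using assms False by (intro cos_monotone_0_pi_le) auto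
  then show ?thesis by (simp add: cos_diff)
qed

text \<open>The trigonometric sum is a single shifted cosine with minimum or maximum at an angle
  \<open>m\<close>. Cut at \<open>m\<close>, each half only involves angular distances to
  \<open>m\<close> in [0, 2 pi], where the quasiconvexity of cosine makes it an interval.\<close>

lemma two_arcs_trig:
  assumes L: "L \<le> 2 * pi"
  shows "two_arcs {\<theta> \<in> {0..L}. t \<le> \<alpha> * cos \<theta> + \<beta> * sin \<theta>}"
proof -
  define S where "S = {\<theta> \<in> {0..L}. t \<le> \<alpha> * cos \<theta> + \<beta> * sin \<theta>}"
  define R where "R = sqrt (\<alpha>\<^sup>2 + \<beta>\<^sup>2)"
  have R: "0 \<le> R" by (simp add: R_def)
  \<comment> \<open>Polar coordinates of the negated coefficient vector: the minus signs turn the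
    superlevel set into a sublevel set of a cosine. If \<open>R = 0\<close>, the angle is arbitrary
    and 0 is taken.\<close>
  obtain m where m: "0 \<le> m" "m < 2 * pi" "- \<alpha> = R * cos m" "- \<beta> = R * sin m"
  proof (cases "R = 0")
    case True
    then have "\<alpha> = 0" "\<beta> = 0" by (auto simp: R_def sum_power2_eq_zero_iff)
    then show ?thesis using that[of 0] True by simp
  next
    case False
    then have R2: "R\<^sup>2 = \<alpha>\<^sup>2 + \<beta>\<^sup>2" by (simp add: R_def)
    have "(- \<alpha> / R)\<^sup>2 + (- \<beta> / R)\<^sup>2 = 1"
      using False by (simp add: power_divide add_divide_distrib[symmetric] R2[symmetric])
    then obtain m where "0 \<le> m" "m < 2 * pi" "- \<alpha> / R = cos m" "- \<beta> / R = sin m"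
      by (rule sincos_total_2pi)
    then show ?thesis using that[of m] False by (auto simp: field_simps)
  qed
  have eq: "\<alpha> * cos \<theta> + \<beta> * sin \<theta> = - (R * cos (\<theta> - m))" for \<theta>
  proof -
    have "\<alpha> = - (R * cos m)" "\<beta> = - (R * sin m)" using m by auto
    then show ?thesis by (simp add: cos_diff algebra_simps)
  qed
  have S: "S = {\<theta> \<in> {0..L}. R * cos (\<theta> - m) \<le> - t}"
    unfolding S_def eq by auto
  have cS: "compact S"
  proof -
    have "S = {0..L} \<inter> {\<theta>. t \<le> \<alpha> * cos \<theta> + \<beta> * sin \<theta>}" by (auto simp: S_def)
    moreover have "closed {\<theta>. t \<le> \<alpha> * cos \<theta> + \<beta> * sin \<theta>}"
      by (intro closed_Collect_le continuous_intros)
    ultimately show ?thesis by (simp add: compact_Int_closed)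
  qed
  have conn: "connected (S \<inter> {..m})"
    unfolding is_interval_connected_1[symmetric] is_interval_1
  proof (intro ballI allI impI)
    fix u1 u2 u assume h: "u1 \<in> S \<inter> {..m}" "u2 \<in> S \<inter> {..m}" "u1 \<le> u \<and> u \<le> u2"
    have "cos (m - u) \<le> max (cos (m - u2)) (cos (m - u1))"
      using h L m by (intro cos_le_max_0_2pi) (auto simp: S)
    then have "cos (u - m) \<le> max (cos (u2 - m)) (cos (u1 - m))"
      by (metis cos_minus minus_diff_eq)
    then have "R * cos (u - m) \<le> max (R * cos (u2 - m)) (R * cos (u1 - m))"
      using R by (metis max_mult_distrib_left mult_left_mono)
    then show "u \<in> S \<inter> {..m}" using h by (auto simp: S)
  qed
  have conn2: "connected (S \<inter> {m..})"
    unfolding is_interval_connected_1[symmetric] is_interval_1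
  proof (intro ballI allI impI)
    fix u1 u2 u assume h: "u1 \<in> S \<inter> {m..}" "u2 \<in> S \<inter> {m..}" "u1 \<le> u \<and> u \<le> u2"
    have "cos (u - m) \<le> max (cos (u1 - m)) (cos (u2 - m))"
      using h L m by (intro cos_le_max_0_2pi) (auto simp: S)
    then have "R * cos (u - m) \<le> max (R * cos (u1 - m)) (R * cos (u2 - m))"
      using R by (metis max_mult_distrib_left mult_left_mono)
    then show "u \<in> S \<inter> {m..}" using h by (auto simp: S)
  qed
  have "(S \<inter> {..m}) \<inter> (S \<inter> {m..}) \<subseteq> {m}" by auto
  then have "finite ((S \<inter> {..m}) \<inter> (S \<inter> {m..}))"
    by (rule finite_subset) simp
  moreover have "S = (S \<inter> {..m}) \<union> (S \<inter> {m..})" by auto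
  moreover have "compact (S \<inter> {..m})" "compact (S \<inter> {m..})"
    using cS by (auto intro: compact_Int_closed)
  ultimately show ?thesis
    unfolding S_def[symmetric] two_arcs_def using conn conn2 by metis
qed

section \<open>Caps in the coordinates of the Lambert square\<close>

definition lambert_inner :: "real^3 \<Rightarrow> real \<times> real \<Rightarrow> real" where
  "lambert_inner w = (\<lambda>(x, y). 2 * sqrt (y - y\<^sup>2) * (w$1 * cos (2 * pi * x) + w$2 * sin (2 * pi * x))
     + w$3 * (1 - 2 * y))"

text \<open>The preimage of a cap, taken in the closed square to make it compact; the edges this
  adds to \<open>unit_square\<close> have area zero. Pairs replace vectors so that areas can be
  computed by slicing.\<close>

definition flat_cap :: "real^3 \<Rightarrow> real \<Rightarrow> (real \<times> real) set" where
  "flat_cap w t = {p \<in> {0..1} \<times> {0..1}. t \<le> lambert_inner w p}"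

lemma continuous_on_lambert_inner: "continuous_on S (lambert_inner w)"
  unfolding lambert_inner_def case_prod_unfold by (intro continuous_intros)

lemma compact_flat_cap: "compact (flat_cap w t)"
proof -
  have "flat_cap w t = ({0..1} \<times> {0..1}) \<inter> {p. t \<le> lambert_inner w p}"
    by (auto simp: flat_cap_def)
  moreover have "closed {p. t \<le> lambert_inner w p}"
    by (intro closed_Collect_le continuous_on_lambert_inner continuous_intros)
  ultimately show ?thesis by (auto intro!: compact_Int_closed compact_Times)
qed

text \<open>For fixed \<open>y\<close> the condition is a trigonometric inequality in
  \<open>2 * pi * x\<close>, and \<open>x\<close> runs through exactly one period.\<close>

lemma two_arcs_horizontal: "two_arcs {x \<in> {0..1}. t \<le> lambert_inner w (x, y)}"
proof -
  define r where "r = 2 * sqrt (y - y\<^sup>2)"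
  let ?T = "{\<theta> \<in> {0..2 * pi}. t - w$3 * (1 - 2 * y) \<le> (r * w$1) * cos \<theta> + (r * w$2) * sin \<theta>}"
  have "{x \<in> {0..1}. t \<le> lambert_inner w (x, y)} = (\<lambda>\<theta>. \<theta> / (2 * pi)) ` ?T"
  proof (intro set_eqI iffI)
    fix x assume "x \<in> {x \<in> {0..1}. t \<le> lambert_inner w (x, y)}"
    then show "x \<in> (\<lambda>\<theta>. \<theta> / (2 * pi)) ` ?T"
      by (intro image_eqI[of _ _ "2 * pi * x"]) (auto simp: lambert_inner_def r_def algebra_simps)
  qed (auto simp: lambert_inner_def r_def algebra_simps)
  moreover have "two_arcs ((\<lambda>\<theta>. \<theta> / (2 * pi)) ` ?T)"
    by (intro two_arcs_image two_arcs_trig continuous_intros) (auto simp: inj_on_def)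
  ultimately show ?thesis by simp
qed

text \<open>The substitution \<open>y = (1 - cos \<theta>) / 2\<close> turns \<open>lambert_inner\<close> along a meridian into a trigonometric sum.\<close>

lemma two_arcs_vertical: "two_arcs {y \<in> {0..1}. t \<le> lambert_inner w (x, y)}"
proof -
  define k where "k = w$1 * cos (2 * pi * x) + w$2 * sin (2 * pi * x)"
  let ?g = "\<lambda>\<theta>. (1 - cos \<theta>) / 2 :: real"
  let ?T = "{\<theta> \<in> {0..pi}. t \<le> w$3 * cos \<theta> + k * sin \<theta>}"
  have h: "lambert_inner w (x, ?g \<theta>) = w$3 * cos \<theta> + k * sin \<theta>" if "\<theta> \<in> {0..pi}" for \<theta>
  proof -
    \<comment> \<open>The radicand becomes the square of half the sine, and the sine is nonnegative
      on [0, pi], so the root resolves without a change of sign.\<close>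
    have "?g \<theta> - (?g \<theta>)\<^sup>2 = (sin \<theta> / 2)\<^sup>2"
      unfolding power_divide sin_squared_eq by (simp add: power2_eq_square field_simps)
    moreover have "0 \<le> sin \<theta> / 2" using that by (simp add: sin_ge_zero)
    ultimately have "2 * sqrt (?g \<theta> - (?g \<theta>)\<^sup>2) = sin \<theta>" by simp
    note s = this
    have "1 - 2 * ?g \<theta> = cos \<theta>" by (simp add: field_simps)
    then show ?thesis unfolding lambert_inner_def k_def prod.case s by (simp only: ac_simps)
  qed
  have "{y \<in> {0..1}. t \<le> lambert_inner w (x, y)} = ?g ` ?T"
  proof (intro set_eqI iffI)
    fix y assume y: "y \<in> {y \<in> {0..1}. t \<le> lambert_inner w (x, y)}"
    \<comment> \<open>\<open>arccos (1 - 2 * y)\<close> inverts the substitution, so every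
      \<open>y\<close> of the unit interval is reached.\<close>
    then have a: "arccos (1 - 2 * y) \<in> {0..pi}" "?g (arccos (1 - 2 * y)) = y"
      by (auto intro: arccos_lbound arccos_ubound simp: cos_arccos)
    then have "t \<le> w$3 * cos (arccos (1 - 2 * y)) + k * sin (arccos (1 - 2 * y))"
      using y h[OF a(1)] by simp
    then show "y \<in> ?g ` ?T"
      using a by (intro image_eqI[of _ _ "arccos (1 - 2 * y)"]) auto
  next
    fix y assume "y \<in> ?g ` ?T"
    then obtain \<theta> where th: "\<theta> \<in> ?T" and y: "y = ?g \<theta>" by blast
    have "y \<in> {0..1}" using cos_le_one[of \<theta>] cos_ge_minus_one[of \<theta>] unfolding y by simp
    moreover have "t \<le> lambert_inner w (x, y)" unfolding y using th h[of \<theta>] by simp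
    ultimately show "y \<in> {y \<in> {0..1}. t \<le> lambert_inner w (x, y)}" by simp
  qed
  moreover have "two_arcs (?g ` ?T)"
    by (intro two_arcs_image two_arcs_trig continuous_intros)
       (auto simp: inj_on_def intro: cos_inj_pi)
  ultimately show ?thesis by simp
qed

section \<open>Area of caps thickened by a rectangle\<close>

definition box_thicken :: "real \<Rightarrow> real \<Rightarrow> (real \<times> real) set \<Rightarrow> (real \<times> real) set" where
  "box_thicken a b S = {p. \<exists>q\<in>S. \<bar>fst p - fst q\<bar> \<le> a \<and> \<bar>snd p - snd q\<bar> \<le> b}"

lemma compact_box_thicken:
  assumes "compact S"
  shows "compact (box_thicken a b S)"
proof -
  \<comment> \<open>The thickening is a Minkowski sum with a rectangle. A sum of compact sets is
    compact, which is what makes the thickened caps Borel.\<close>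
  have "box_thicken a b S = {p + q |p q. p \<in> S \<and> q \<in> {- a..a} \<times> {- b..b}}" (is "_ = ?R")
  proof (intro set_eqI iffI)
    fix p assume "p \<in> box_thicken a b S"
    then obtain q where "q \<in> S" "\<bar>fst p - fst q\<bar> \<le> a" "\<bar>snd p - snd q\<bar> \<le> b"
      by (auto simp: box_thicken_def)
    then show "p \<in> ?R"
      by (intro CollectI exI[of _ q] exI[of _ "p - q"]) (auto simp: mem_Times_iff abs_le_iff)
  next
    fix p assume "p \<in> ?R"
    then obtain q r where "p = q + r" "q \<in> S" "r \<in> {- a..a} \<times> {- b..b}" by blast
    then show "p \<in> box_thicken a b S"
      unfolding box_thicken_def by (intro CollectI bexI[of _ q]) (auto simp: mem_Times_iff abs_le_iff)
  qed
  moreover have "compact ?R"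
    using assms by (intro compact_sums compact_Times) auto
  ultimately show ?thesis by simp
qed

text \<open>Each horizontal slice gains at most \<open>4 * a\<close> in length, and only heights in
  [0, 1] contribute, so integrating over the heights gives the bound.\<close>

lemma emeasure_thicken_horizontal:
  assumes a: "0 \<le> a"
  shows "emeasure lborel (box_thicken a 0 (flat_cap w t)) \<le> emeasure lborel (flat_cap w t) + ennreal (4 * a)"
proof -
  let ?A = "flat_cap w t" and ?B = "box_thicken a 0 (flat_cap w t)"
  have A: "?A \<in> sets (lborel \<Otimes>\<^sub>M lborel)" and B: "?B \<in> sets (lborel \<Otimes>\<^sub>M lborel)"
    unfolding lborel_prod using compact_flat_cap compact_box_thicken[OF compact_flat_cap]
    by (auto simp: borel_compact)
  have sl: "emeasure lborel ((\<lambda>x. (x, y)) -` ?B) \<le>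
      emeasure lborel ((\<lambda>x. (x, y)) -` ?A) + ennreal (4 * a) * indicator {0..1} y" for y
  proof (cases "y \<in> {0..1}")
    case True
    let ?S = "{x \<in> {0..1}. t \<le> lambert_inner w (x, y)}"
    have "(\<lambda>x. (x, y)) -` ?A = ?S" using True by (auto simp: flat_cap_def)
    moreover have "(\<lambda>x. (x, y)) -` ?B = {x. \<exists>x'\<in>?S. \<bar>x - x'\<bar> \<le> a}"
      using True by (auto simp: flat_cap_def box_thicken_def)
    ultimately show ?thesis
      using emeasure_thicken_two_arcs[OF two_arcs_horizontal a, of t w y] True by simp
  next
    case False
    then have "(\<lambda>x. (x, y)) -` ?B = {}" by (auto simp: flat_cap_def box_thicken_def)
    then show ?thesis by simp
  qed
  have mA: "(\<lambda>y. emeasure lborel ((\<lambda>x. (x, y)) -` ?A)) \<in> borel_measurable lborel"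
    using lborel_pair.measurable_emeasure_Pair2[OF A] by simp
  have "emeasure lborel ?B = (\<integral>\<^sup>+y. emeasure lborel ((\<lambda>x. (x, y)) -` ?B) \<partial>lborel)"
    using lborel_pair.emeasure_pair_measure_alt2[OF B] by (simp add: lborel_prod)
  also have "\<dots> \<le> (\<integral>\<^sup>+y. emeasure lborel ((\<lambda>x. (x, y)) -` ?A) + ennreal (4 * a) * indicator {0..1} y \<partial>lborel)"
    by (intro nn_integral_mono sl)
  also have "\<dots> = (\<integral>\<^sup>+y. emeasure lborel ((\<lambda>x. (x, y)) -` ?A) \<partial>lborel) + ennreal (4 * a)"
    using mA a by (subst nn_integral_add) (auto simp: nn_integral_cmult_indicator)
  also have "(\<integral>\<^sup>+y. emeasure lborel ((\<lambda>x. (x, y)) -` ?A) \<partial>lborel) = emeasure lborel ?A"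
    using lborel_pair.emeasure_pair_measure_alt2[OF A] by (simp add: lborel_prod)
  finally show ?thesis .
qed

text \<open>
  On every vertical line the horizontally thickened cap coincides with a vertical slice of the cap
  itself, namely the one through the point \<open>x'\<close> of the window \<open>[x - a, x + a]\<close> where the coefficient
  of \<open>sqrt (y - y\<^sup>2)\<close> is largest. So vertical thickening again acts on at most two segments.
\<close>

lemma emeasure_box_thicken_flat_cap:
  assumes a: "0 \<le> a" and b: "0 \<le> b"
  shows "emeasure lborel (box_thicken a b (flat_cap w t))
    \<le> emeasure lborel (flat_cap w t) + ennreal (4 * a + 4 * b * (1 + 2 * a))"
proof -
  let ?B = "box_thicken a 0 (flat_cap w t)" and ?D = "box_thicken a b (flat_cap w t)"
  have D: "?D \<in> sets (lborel \<Otimes>\<^sub>M lborel)" and B: "?B \<in> sets (lborel \<Otimes>\<^sub>M lborel)"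
    unfolding lborel_prod using compact_flat_cap compact_box_thicken[OF compact_flat_cap]
    by (auto simp: borel_compact)
  define k where "k x = w$1 * cos (2 * pi * x) + w$2 * sin (2 * pi * x)" for x
  have hk: "lambert_inner w (x, y) = 2 * sqrt (y - y\<^sup>2) * k x + w$3 * (1 - 2 * y)" for x y
    by (simp add: lambert_inner_def k_def)
  \<comment> \<open>Horizontal thickening spreads the square to width \<open>1 + 2 * a\<close>; this
    is the number of vertical lines, by measure, on which the gain \<open>4 * b\<close> is
    paid.\<close>
  have sl: "emeasure lborel (Pair x -` ?D) \<le>
      emeasure lborel (Pair x -` ?B) + ennreal (4 * b) * indicator {- a..1 + a} x" for x
  proof (cases "x \<in> {- a..1 + a}")
    case True
    \<comment> \<open>The window is clipped to the unit interval over which the cap lies, and is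
      nonempty because \<open>x\<close> is within \<open>a\<close> of that interval.\<close>
    let ?W = "{max 0 (x - a)..min 1 (x + a)}"
    have "compact ?W" "?W \<noteq> {}" using True a by auto
    moreover have "continuous_on ?W k" unfolding k_def by (intro continuous_intros)
    ultimately obtain x' where x': "x' \<in> ?W" "\<And>z. z \<in> ?W \<Longrightarrow> k z \<le> k x'"
      by (metis continuous_attains_sup)
    let ?S = "{y \<in> {0..1}. t \<le> lambert_inner w (x', y)}"
    have mono: "lambert_inner w (z, y) \<le> lambert_inner w (x', y)" if "z \<in> ?W" "y \<in> {0..1}" for z y
    proof -
      have "0 \<le> y - y\<^sup>2"
        using that(2) by (simp add: power2_eq_square mult_left_le)
      then show ?thesis
        unfolding hk using x'(2)[OF that(1)] by (intro add_right_mono mult_left_mono) auto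
    qed
    \<comment> \<open>The free predicate lets one equivalence serve both thickenings: vertical
      distance 0 gives the slice of \<open>?B\<close>, distance at most \<open>b\<close> that of
      \<open>?D\<close>.\<close>
    have ex: "(\<exists>q\<in>flat_cap w t. \<bar>x - fst q\<bar> \<le> a \<and> P (snd q)) \<longleftrightarrow> (\<exists>y\<in>?S. P y)" for P
    proof
      assume "\<exists>q\<in>flat_cap w t. \<bar>x - fst q\<bar> \<le> a \<and> P (snd q)"
      then obtain z y where zy: "(z, y) \<in> flat_cap w t" "\<bar>x - z\<bar> \<le> a" "P y" by auto
      then have "y \<in> {0..1}" "z \<in> ?W" "t \<le> lambert_inner w (z, y)"
        by (auto simp: flat_cap_def)
      then show "\<exists>y\<in>?S. P y" using mono[of z y] zy by (intro bexI[of _ y]) auto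
    next
      assume "\<exists>y\<in>?S. P y"
      then obtain y where "y \<in> ?S" "P y" by blast
      then show "\<exists>q\<in>flat_cap w t. \<bar>x - fst q\<bar> \<le> a \<and> P (snd q)"
        using x'(1) by (intro bexI[of _ "(x', y)"]) (auto simp: flat_cap_def)
    qed
    have "Pair x -` ?B = ?S"
      using ex[of "\<lambda>y. \<bar>_ - y\<bar> \<le> 0"] by (auto simp: box_thicken_def)
    moreover have "Pair x -` ?D = {y. \<exists>y'\<in>?S. \<bar>y - y'\<bar> \<le> b}"
      using ex[of "\<lambda>y. \<bar>_ - y\<bar> \<le> b"] by (auto simp: box_thicken_def)
    ultimately show ?thesis
      using emeasure_thicken_two_arcs[OF two_arcs_vertical b, of t w x'] True by simp
  next
    case False
    then have "Pair x -` ?D = {}" by (auto simp: flat_cap_def box_thicken_def)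
    then show ?thesis by simp
  qed
  have mB: "(\<lambda>x. emeasure lborel (Pair x -` ?B)) \<in> borel_measurable lborel"
    using lborel.measurable_emeasure_Pair[OF B] by simp
  have "emeasure lborel ?D = (\<integral>\<^sup>+x. emeasure lborel (Pair x -` ?D) \<partial>lborel)"
    using lborel.emeasure_pair_measure_alt[OF D] by (simp add: lborel_prod)
  also have "\<dots> \<le> (\<integral>\<^sup>+x. emeasure lborel (Pair x -` ?B) + ennreal (4 * b) * indicator {- a..1 + a} x \<partial>lborel)"
    by (intro nn_integral_mono sl)
  also have "\<dots> = (\<integral>\<^sup>+x. emeasure lborel (Pair x -` ?B) \<partial>lborel) + ennreal (4 * b) * ennreal (1 + 2 * a)"
    using mB a by (subst nn_integral_add) (auto simp: nn_integral_cmult_indicator add.commute)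
  also have "(\<integral>\<^sup>+x. emeasure lborel (Pair x -` ?B) \<partial>lborel) = emeasure lborel ?B"
    using lborel.emeasure_pair_measure_alt[OF B] by (simp add: lborel_prod)
  also have "emeasure lborel ?B + ennreal (4 * b) * ennreal (1 + 2 * a) \<le>
      (emeasure lborel (flat_cap w t) + ennreal (4 * a)) + ennreal (4 * b) * ennreal (1 + 2 * a)"
    by (intro add_right_mono emeasure_thicken_horizontal a)
  also have "\<dots> = emeasure lborel (flat_cap w t) + (ennreal (4 * a) + ennreal (4 * b) * ennreal (1 + 2 * a))"
    by (simp add: ac_simps)
  also have "ennreal (4 * a) + ennreal (4 * b) * ennreal (1 + 2 * a) = ennreal (4 * a + 4 * b * (1 + 2 * a))"
    using a b by (simp add: ennreal_mult[symmetric] ennreal_plus[symmetric] del: ennreal_plus)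
  finally show ?thesis .
qed

section \<open>Area preservation of the Lambert map\<close>

lemma prod_Basis_vec: "(\<Prod>b\<in>Basis. (v :: real^'n) \<bullet> b) = (\<Prod>i\<in>UNIV. v $ i)"
proof -
  have B: "(Basis :: (real^'n) set) = (\<lambda>i. axis i 1) ` UNIV"
    by (auto simp: Basis_vec_def)
  moreover have "inj (\<lambda>i::'n. axis i (1::real))"
    by (auto simp: inj_on_def axis_eq_axis)
  ultimately show ?thesis
    unfolding B by (subst prod.reindex) (auto simp: inner_axis)
qed

lemma box_Pair_eq: "box (a, c) (b, d) = box a b \<times> box c d"
  by (auto simp: box_def Basis_prod_def ball_Un)

text \<open>\<open>vec2\<close> and \<open>vec3\<close> identify product types, where Lebesgue
  measure is a product measure and slicing applies, with the vector types on which the Lambert map,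
  the sphere and the tiles live.\<close>

definition vec2 :: "real \<times> real \<Rightarrow> real^2" where
  "vec2 = (\<lambda>(x, y). x *\<^sub>R axis 1 1 + y *\<^sub>R axis 2 1)"

definition vec3 :: "real \<times> real \<times> real \<Rightarrow> real^3" where
  "vec3 = (\<lambda>(s, x, y). s *\<^sub>R axis 1 1 + x *\<^sub>R axis 2 1 + y *\<^sub>R axis 3 1)"

lemma vec2_nth [simp]: "vec2 p $ 1 = fst p" "vec2 p $ 2 = snd p"
  by (auto simp: vec2_def axis_def case_prod_unfold)

lemma vec3_nth [simp]: "vec3 p $ 1 = fst p" "vec3 p $ 2 = fst (snd p)" "vec3 p $ 3 = snd (snd p)"
  by (auto simp: vec3_def axis_def case_prod_unfold)

lemma measurable_vec2 [measurable]: "vec2 \<in> borel_measurable borel"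
  unfolding vec2_def case_prod_unfold by (intro borel_measurable_continuous_onI continuous_intros)

lemma measurable_vec3 [measurable]: "vec3 \<in> borel_measurable borel"
  unfolding vec3_def case_prod_unfold by (intro borel_measurable_continuous_onI continuous_intros)

text \<open>Lebesgue measure is determined by its values on boxes, and the preimage of a box is a
  product of intervals.\<close>

lemma lborel_vec2: "lborel = distr lborel borel vec2"
proof (rule lborel_eqI)
  fix l u :: "real^2" assume le: "\<And>b. b \<in> Basis \<Longrightarrow> l \<bullet> b \<le> u \<bullet> b"
  have le': "l $ i \<le> u $ i" for i
    using le[of "axis i 1"] by (simp add: inner_axis)
  have "vec2 -` box l u = box (l $ 1, l $ 2) (u $ 1, u $ 2)"
    unfolding box_Pair_eq by (auto simp: mem_box_cart forall_2)
  then have "emeasure (distr lborel borel vec2) (box l u) = emeasure lborel (box (l $ 1, l $ 2) (u $ 1, u $ 2))"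
    by (subst emeasure_distr) auto
  also have "\<dots> = (u $ 1 - l $ 1) * (u $ 2 - l $ 2)"
    unfolding box_Pair_eq lborel_prod[symmetric] using le'
    by (subst lborel.emeasure_pair_measure_Times) (auto simp: ennreal_mult)
  finally show "emeasure (distr lborel borel vec2) (box l u) = (\<Prod>b\<in>Basis. (u - l) \<bullet> b)"
    unfolding prod_Basis_vec by (simp add: UNIV_2)
qed simp

lemma prod_3: "prod f (UNIV :: 3 set) = f 1 * (f 2 * f 3)" for f :: "3 \<Rightarrow> real"
  unfolding UNIV_3 by simp

lemma lborel_vec3: "lborel = distr lborel borel vec3"
proof (rule lborel_eqI)
  fix l u :: "real^3" assume le: "\<And>b. b \<in> Basis \<Longrightarrow> l \<bullet> b \<le> u \<bullet> b"
  have le': "l $ i \<le> u $ i" for i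
    using le[of "axis i 1"] by (simp add: inner_axis)
  let ?l = "(l $ 1, l $ 2, l $ 3)" and ?u = "(u $ 1, u $ 2, u $ 3)"
  have "vec3 -` box l u = box ?l ?u"
    unfolding box_Pair_eq by (auto simp: mem_box_cart forall_3)
  then have "emeasure (distr lborel borel vec3) (box l u) = emeasure lborel (box ?l ?u)"
    by (subst emeasure_distr) auto
  also have "\<dots> = ennreal (u $ 1 - l $ 1) * emeasure lborel (box (l $ 2, l $ 3) (u $ 2, u $ 3))"
    unfolding box_Pair_eq[of "l $ 1"] lborel_prod[symmetric, where 'b = "real \<times> real"] using le'
    by (subst lborel.emeasure_pair_measure_Times) auto
  also have "emeasure lborel (box (l $ 2, l $ 3) (u $ 2, u $ 3)) = ennreal ((u $ 2 - l $ 2) * (u $ 3 - l $ 3))"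
    unfolding box_Pair_eq lborel_prod[symmetric] using le'
    by (subst lborel.emeasure_pair_measure_Times) (auto simp: ennreal_mult)
  also have "ennreal (u $ 1 - l $ 1) * \<dots> = ennreal ((u $ 1 - l $ 1) * ((u $ 2 - l $ 2) * (u $ 3 - l $ 3)))"
    using le'[of 1] by (intro ennreal_mult'[symmetric]) simp
  finally show "emeasure (distr lborel borel vec3) (box l u) = (\<Prod>b\<in>Basis. (u - l) \<bullet> b)"
    unfolding prod_Basis_vec prod_3 by simp
qed simp

section \<open>The Lambert map and its radial extension to the ball\<close>

lemma lambert_nth:
  "lambert v $ 1 = 2 * sqrt (v$2 - (v$2)\<^sup>2) * cos (2 * pi * v$1)"
  "lambert v $ 2 = 2 * sqrt (v$2 - (v$2)\<^sup>2) * sin (2 * pi * v$1)"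
  "lambert v $ 3 = 1 - 2 * v$2"
  by (simp_all add: lambert_def Let_def)

lemma inner_lambert: "w \<bullet> lambert v = lambert_inner w (v $ 1, v $ 2)"
  by (simp add: inner_vec_def sum_3 lambert_nth lambert_inner_def algebra_simps)

lemma sq_less_self:
  fixes y :: real
  assumes "0 < y" "y < 1"
  shows "0 < y - y\<^sup>2"
proof -
  have "0 < y * (1 - y)" using assms by simp
  then show ?thesis by (simp add: power2_eq_square algebra_simps)
qed

lemma norm_lambert:
  assumes "v \<in> unit_square"
  shows "norm (lambert v) = 1"
proof -
  have p: "0 < v$2 - (v$2)\<^sup>2"
    using assms by (intro sq_less_self) (auto simp: unit_square_def)
  define q where "q = v$2 - (v$2)\<^sup>2"
  have "(norm (lambert v))\<^sup>2 = (2 * sqrt q * cos (2 * pi * v$1))\<^sup>2 + (2 * sqrt q * sin (2 * pi * v$1))\<^sup>2 + (1 - 2 * v$2)\<^sup>2"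
    unfolding power2_norm_eq_inner q_def by (simp add: inner_vec_def sum_3 lambert_nth power2_eq_square)
  also have "\<dots> = 4 * q + (1 - 2 * v$2)\<^sup>2"
    using p by (simp add: q_def[symmetric] power_mult_distrib flip: distrib_left)
  also have "\<dots> = 1"
    by (simp add: q_def power2_eq_square algebra_simps)
  finally show ?thesis by (simp add: power2_eq_1_iff) (use norm_ge_zero[of "lambert v"] in linarith)
qed

text \<open>The third coordinate determines the height. Away from the poles the radius of the
  parallel is positive, so cosine and sine determine the first coordinate modulo 1, and it lies in
  [0, 1).\<close>

lemma inj_on_lambert: "inj_on lambert unit_square"
proof (rule inj_onI)
  fix u v assume u: "u \<in> unit_square" and v: "v \<in> unit_square" and eq: "lambert u = lambert v"
  have y: "u $ 2 = v $ 2"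
    using arg_cong[OF eq, of "\<lambda>x. x $ 3"] by (simp add: lambert_nth)
  have "0 < v$2 - (v$2)\<^sup>2"
    using v by (intro sq_less_self) (auto simp: unit_square_def)
  then have "cos (2 * pi * u$1) = cos (2 * pi * v$1)" "sin (2 * pi * u$1) = sin (2 * pi * v$1)"
    using arg_cong[OF eq, of "\<lambda>x. x $ 1"] arg_cong[OF eq, of "\<lambda>x. x $ 2"]
    by (auto simp: lambert_nth y)
  then obtain n :: int where "2 * pi * u$1 = 2 * pi * v$1 + 2 * pi * n"
    using sin_cos_eq_iff by metis
  then have "2 * pi * (u$1) = 2 * pi * (v$1 + n)" by (simp add: algebra_simps)
  then have n: "u$1 = v$1 + n" by simp
  then have "\<bar>real_of_int n\<bar> < 1" using u v by (auto simp: unit_square_def)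
  then have "n = 0" by linarith
  then show "u = v" using n y by (simp add: vec_eq_iff forall_2)
qed

definition lambert_cone :: "real^3 \<Rightarrow> real^3" where
  "lambert_cone u = root 3 (u$1) *\<^sub>R lambert (vec2 (u$2, u$3))"

text \<open>
  Parametrising the radius as the cube root of the first coordinate makes the Jacobian constant.
\<close>

lemma lambert_cone_derivative:
  assumes u: "0 < u$1" "0 < u$3" "u$3 < 1"
  obtains D where "(lambert_cone has_derivative D) (at u within S)" "\<bar>det (matrix D)\<bar> = 4 * pi / 3"
proof -
  define q where "q = u$3 - (u$3)\<^sup>2"
  define R where "R = root 3 (u$1)"
  define R' where "R' = inverse (3 * R\<^sup>2)"
  define P where "P = 2 * sqrt q"
  define P' where "P' = (1 - 2 * u$3) / sqrt q"
  define c where "c = cos (2 * pi * u$2)"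
  define s where "s = sin (2 * pi * u$2)"
  define h where "h = 1 - 2 * u$3"
  have q: "0 < q" unfolding q_def using u by (intro sq_less_self) auto
  have R: "0 < R" using u by (simp add: R_def)
  have n: "((\<lambda>v. v $ i) has_derivative (\<lambda>d. d $ i)) (at u within S)" for i :: 3
    by (rule bounded_linear_imp_has_derivative[OF bounded_linear_vec_nth])
  have dR: "((\<lambda>v. root 3 (v$1)) has_derivative (\<lambda>d. d$1 * R')) (at u within S)"
  proof -
    have "DERIV (root 3) (u$1) :> R'"
      using DERIV_real_root[of 3 "u$1"] u by (simp add: R'_def R_def numeral_eq_Suc)
    then show ?thesis by (rule DERIV_compose_FDERIV[OF _ n])
  qed
  have dP: "((\<lambda>v. 2 * sqrt (v$3 - (v$3)\<^sup>2)) has_derivative (\<lambda>d. d$3 * P')) (at u within S)"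
  proof -
    have "DERIV (\<lambda>y. 2 * sqrt (y - y\<^sup>2)) (u$3) :> P'"
      using q unfolding P'_def q_def by (auto intro!: derivative_eq_intros simp: field_simps)
    then show ?thesis by (rule DERIV_compose_FDERIV[OF _ n])
  qed
  have dc: "((\<lambda>v. cos (2 * pi * v$2)) has_derivative (\<lambda>d. d$2 * (- 2 * pi * s))) (at u within S)"
  proof -
    have "DERIV (\<lambda>x. cos (2 * pi * x)) (u$2) :> - 2 * pi * s"
      unfolding s_def by (auto intro!: derivative_eq_intros)
    then show ?thesis by (rule DERIV_compose_FDERIV[OF _ n])
  qed
  have ds: "((\<lambda>v. sin (2 * pi * v$2)) has_derivative (\<lambda>d. d$2 * (2 * pi * c))) (at u within S)"
  proof -
    have "DERIV (\<lambda>x. sin (2 * pi * x)) (u$2) :> 2 * pi * c"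
      unfolding c_def by (auto intro!: derivative_eq_intros)
    then show ?thesis by (rule DERIV_compose_FDERIV[OF _ n])
  qed
  have dh: "((\<lambda>v. 1 - 2 * v$3) has_derivative (\<lambda>d. - 2 * d$3)) (at u within S)"
    by (auto intro!: derivative_eq_intros n)
  \<comment> \<open>The columns are the derivatives in the radial parameter, the longitude and the
    height; the zero records that the third coordinate is free of the longitude.\<close>
  define J :: "real^3^3" where "J = vector [vector [R' * P * c, - 2 * pi * R * P * s, R * P' * c],
    vector [R' * P * s, 2 * pi * R * P * c, R * P' * s], vector [R' * h, 0, - 2 * R]]"
  have comp: "((\<lambda>v. lambert_cone v $ i) has_derivative (\<lambda>d. (J *v d) $ i)) (at u within S)" for i
  proof -
    have "\<forall>i. ((\<lambda>v. lambert_cone v $ i) has_derivative (\<lambda>d. (J *v d) $ i)) (at u within S)"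
      unfolding forall_3
    proof (intro conjI)
      show "((\<lambda>v. lambert_cone v $ 1) has_derivative (\<lambda>d. (J *v d) $ 1)) (at u within S)"
        by (rule has_derivative_eq_rhs, simp add: lambert_cone_def lambert_nth,
            rule has_derivative_mult[OF dR has_derivative_mult[OF dP dc]])
           (auto simp: fun_eq_iff J_def matrix_vector_mult_def sum_3 R_def q_def P_def c_def s_def algebra_simps)
      show "((\<lambda>v. lambert_cone v $ 2) has_derivative (\<lambda>d. (J *v d) $ 2)) (at u within S)"
        by (rule has_derivative_eq_rhs, simp add: lambert_cone_def lambert_nth,
            rule has_derivative_mult[OF dR has_derivative_mult[OF dP ds]])
           (auto simp: fun_eq_iff J_def matrix_vector_mult_def sum_3 R_def q_def P_def c_def s_def algebra_simps)
      show "((\<lambda>v. lambert_cone v $ 3) has_derivative (\<lambda>d. (J *v d) $ 3)) (at u within S)"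
        by (rule has_derivative_eq_rhs, simp add: lambert_cone_def lambert_nth,
            rule has_derivative_mult[OF dR dh])
           (auto simp: fun_eq_iff J_def matrix_vector_mult_def sum_3 R_def h_def algebra_simps)
    qed
    then show ?thesis by blast
  qed
  have "(lambert_cone has_derivative (*v) J) (at u within S)"
    unfolding has_derivative_componentwise_within[of lambert_cone]
    using comp by (auto simp: Basis_vec_def inner_axis)
  moreover have "\<bar>det (matrix ((*v) J))\<bar> = 4 * pi / 3"
  proof -
    \<comment> \<open>\<open>P'\<close> blows up at the poles, but enters the determinant only
      through \<open>P * P'\<close>, where the square roots cancel. The factor 1/3 comes from the
      cube root.\<close>
    have e: "c\<^sup>2 + s\<^sup>2 = 1" "P\<^sup>2 + h\<^sup>2 = 1" "P * P' = 2 * h" "R' * R\<^sup>2 = 1 / 3"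
    proof -
      show "c\<^sup>2 + s\<^sup>2 = 1" by (simp add: c_def s_def)
      have "P\<^sup>2 = 4 * q" using q by (simp add: P_def power_mult_distrib)
      then show "P\<^sup>2 + h\<^sup>2 = 1" by (simp add: q_def h_def power2_eq_square algebra_simps)
      show "P * P' = 2 * h" using q by (simp add: P_def P'_def h_def)
      show "R' * R\<^sup>2 = 1 / 3" using R by (simp add: R'_def)
    qed
    have "det J = - 2 * pi * (R' * R\<^sup>2) * (c\<^sup>2 + s\<^sup>2) * (2 * P\<^sup>2 + h * (P * P'))"
      unfolding det_3 J_def by (simp add: power2_eq_square algebra_simps)
    also have "\<dots> = - 2 * pi * (1 / 3) * (2 * (P\<^sup>2 + h\<^sup>2))"
      unfolding e(1,3,4) by (simp add: power2_eq_square)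
    also have "\<dots> = - (4 * pi / 3)" unfolding e(2) by simp
    finally show ?thesis by simp
  qed
  ultimately show ?thesis by (rule that)
qed

lemma borel_cap: "cap w t \<in> sets borel"
proof -
  have "cap w t = sphere 0 1 \<inter> {x. t \<le> w \<bullet> x}" by (auto simp: cap_def)
  moreover have "closed {x. t \<le> w \<bullet> x}" by (intro closed_Collect_le continuous_intros)
  ultimately show ?thesis by (auto intro: borel_closed)
qed

text \<open>
  Only this inequality is needed: applied to a cap and to its complementary cap, it yields both
  directions of the discrepancy estimate.
\<close>

lemma sphere_measure_cap_ge:
  "emeasure lborel (flat_cap w t) \<le> emeasure sphere_measure (cap w t)"
proof -
  \<comment> \<open>Radial parameter times open flat cap. The faces of the cube are left out so that
    the cube root and the square root are differentiable.\<close>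
  define S where "S = {u :: real^3. 0 < u$1 \<and> u$1 < 1 \<and> 0 < u$2 \<and> u$2 < 1 \<and> 0 < u$3 \<and> u$3 < 1 \<and>
    t \<le> lambert_inner w (u$2, u$3)}"
  let ?A = "flat_cap w t \<inter> ({0<..<1} \<times> {0<..<1})"
  have mh [measurable]: "lambert_inner w \<in> borel_measurable borel"
    using continuous_on_lambert_inner by (rule borel_measurable_continuous_onI)
  have mn [measurable]: "(\<lambda>u. u $ i) \<in> borel_measurable borel" for i :: 3
    by (intro borel_measurable_continuous_onI continuous_intros)
  have bA: "?A \<in> sets borel"
    using borel_compact[OF compact_flat_cap, of w t] borel_open[OF open_Times[of "{0<..<1::real}" "{0<..<1::real}"]] by auto
  have bS: "S \<in> sets borel"
    unfolding S_def by measurable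
  \<comment> \<open>Passing to the open square only removes a part of its boundary, which is
    null.\<close>
  have eA: "emeasure lborel ?A = emeasure lborel (flat_cap w t)"
  proof (rule antisym)
    show "emeasure lborel ?A \<le> emeasure lborel (flat_cap w t)"
      using compact_flat_cap[of w t] by (intro emeasure_mono) (auto simp: borel_compact)
    let ?Z = "cbox (0, 0) (1, 1) - box (0, 0) (1, 1 :: real) :: (real \<times> real) set"
    have "emeasure lborel ?Z = 0"
      by (subst emeasure_Diff) (auto simp: emeasure_lborel_box_eq emeasure_lborel_cbox_eq box_subset_cbox)
    moreover have "emeasure lborel (flat_cap w t) \<le> emeasure lborel (?A \<union> ?Z)"
    proof (rule emeasure_mono)
      show "flat_cap w t \<subseteq> ?A \<union> ?Z"
        by (auto simp: flat_cap_def box_Pair_eq cbox_Pair_eq)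
      show "?A \<union> ?Z \<in> sets lborel" using bA by auto
    qed
    moreover have "emeasure lborel (?A \<union> ?Z) \<le> emeasure lborel ?A + emeasure lborel ?Z"
      using bA by (intro emeasure_subadditive) auto
    ultimately show "emeasure lborel (flat_cap w t) \<le> emeasure lborel ?A" by simp
  qed
  have eS: "emeasure lborel S = emeasure lborel ?A"
  proof -
    have "vec3 -` S = {0<..<1} \<times> ?A"
      by (auto simp: S_def flat_cap_def)
    then have "emeasure lborel S = emeasure lborel ({0<..<1 :: real} \<times> ?A)"
      using bS by (subst lborel_vec3, subst emeasure_distr) auto
    also have "\<dots> = emeasure lborel {0<..<1 :: real} * emeasure lborel ?A"
      unfolding lborel_prod[symmetric, where 'b = "real \<times> real"] using bA
      by (subst lborel.emeasure_pair_measure_Times) auto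
    finally show ?thesis by simp
  qed
  have lS: "S \<in> lmeasurable"
  proof (intro bounded_set_imp_lmeasurable)
    show "bounded S"
      by (rule bounded_subset[OF bounded_box[of "0 :: real^3" 1]]) (auto simp: S_def mem_box_cart forall_3)
    show "S \<in> sets lebesgue" using bS by auto
  qed
  have "\<forall>u\<in>S. \<exists>D. (lambert_cone has_derivative D) (at u within S) \<and> \<bar>det (matrix D)\<bar> = 4 * pi / 3"
  proof
    fix u assume "u \<in> S"
    then have "0 < u$1" "0 < u$3" "u$3 < 1" by (auto simp: S_def)
    from lambert_cone_derivative[OF this, of S]
    show "\<exists>D. (lambert_cone has_derivative D) (at u within S) \<and> \<bar>det (matrix D)\<bar> = 4 * pi / 3"
      by metis
  qed
  then obtain D where D: "\<And>u. u \<in> S \<Longrightarrow> (lambert_cone has_derivative D u) (at u within S)"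
    "\<And>u. u \<in> S \<Longrightarrow> \<bar>det (matrix (D u))\<bar> = 4 * pi / 3"
    by metis
  have sq: "vec2 (u$2, u$3) \<in> unit_square" if "u \<in> S" for u
    using that by (auto simp: S_def unit_square_def)
  have nrm: "norm (lambert_cone u) = root 3 (u$1)" if "u \<in> S" for u
    using norm_lambert[OF sq[OF that]] that by (simp add: lambert_cone_def S_def)
  have pos: "0 < root 3 (u$1)" if "u \<in> S" for u
    using that by (simp add: S_def)
  have inj: "inj_on lambert_cone S"
  proof (rule inj_onI)
    fix u v assume u: "u \<in> S" and v: "v \<in> S" and eq: "lambert_cone u = lambert_cone v"
    have r: "root 3 (u$1) = root 3 (v$1)"
      using nrm[OF u] nrm[OF v] eq by simp
    then have "lambert (vec2 (u$2, u$3)) = lambert (vec2 (v$2, v$3))"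
      using eq pos[OF v] by (simp add: lambert_cone_def)
    then have "vec2 (u$2, u$3) = vec2 (v$2, v$3)"
      using inj_on_lambert sq[OF u] sq[OF v] by (auto dest: inj_onD)
    then show "u = v" using r by (simp add: vec_eq_iff forall_2 forall_3)
  qed
  \<comment> \<open>With a constant Jacobian the change of variables formula merely multiplies the
    volume of \<open>S\<close> by that constant.\<close>
  have "((\<lambda>u. \<bar>det (matrix (D u))\<bar>) has_integral 4 * pi / 3 * measure lebesgue S) S"
  proof -
    have "((\<lambda>u. 4 * pi / 3 * 1) has_integral 4 * pi / 3 * measure lebesgue S) S"
      using has_integral_measure_lborel[OF bS] lS bS by (intro has_integral_mult_right) (auto simp: fmeasurable_def)
    then show ?thesis
      by (rule has_integral_eq[rotated]) (simp add: D)
  qed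
  then have img: "lambert_cone ` S \<in> lmeasurable" "measure lebesgue (lambert_cone ` S) = 4 * pi / 3 * measure lebesgue S"
    using has_measure_differentiable_image[OF fmeasurableD[OF lS] D(1) inj] by blast+
  let ?C = "{x \<in> cball 0 1. sgn x \<in> cap w t}"
  note bcap = borel_cap[of w t]
  have bC: "?C \<in> sets borel"
  proof -
    have "sgn -` cap w t \<in> sets borel"
      using measurable_sets[OF borel_measurable_sgn bcap] by simp
    moreover have "?C = cball 0 1 \<inter> sgn -` cap w t" by auto
    ultimately show ?thesis by auto
  qed
  \<comment> \<open>\<open>sgn\<close> discards the radius and returns the Lambert point, so the
    image lies in the solid cone over the cap.\<close>
  have sub: "lambert_cone ` S \<subseteq> ?C"
  proof
    fix x assume "x \<in> lambert_cone ` S"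
    then obtain u where u: "u \<in> S" "x = lambert_cone u" by blast
    have "sgn x = lambert (vec2 (u$2, u$3))"
      using pos[OF u(1)] norm_lambert[OF sq[OF u(1)]] unfolding u(2) lambert_cone_def
      by (simp add: sgn_div_norm)
    moreover have "norm x \<le> 1" using u nrm[OF u(1)] by (simp add: S_def)
    ultimately show "x \<in> ?C"
      using norm_lambert[OF sq[OF u(1)]] u(1) by (auto simp: cap_def inner_lambert S_def)
  qed
  have "emeasure lborel S = ennreal (measure lebesgue S)"
    using emeasure_eq_measure2[OF lS] bS by simp
  then have "ennreal (4 * pi / 3) * emeasure lborel S = emeasure lebesgue (lambert_cone ` S)"
    unfolding emeasure_eq_measure2[OF img(1)] img(2) by (simp only: ennreal_mult'[symmetric] pi_ge_zero divide_nonneg_pos mult_nonneg_nonneg zero_le_numeral zero_less_numeral)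
  also have "\<dots> \<le> emeasure lebesgue ?C"
    using sub bC by (intro emeasure_mono) auto
  also have "\<dots> = emeasure lborel ?C" using bC by simp
  finally have main: "ennreal (4 * pi / 3) * emeasure lborel S \<le> emeasure lborel ?C" .
  \<comment> \<open>The Jacobian constant equals the volume of the unit ball, so the normalization
    in \<open>sphere_measure\<close> cancels it.\<close>
  have ball: "emeasure lborel (cball 0 1 :: (real^3) set) = ennreal (4 * pi / 3)"
    by (simp add: emeasure_cball unit_ball_vol_3)
  have "emeasure lborel S = ennreal (4 * pi / 3) * emeasure lborel S / ennreal (4 * pi / 3)"
    by (simp add: ennreal_mult_divide_eq mult.commute)
  also have "\<dots> \<le> emeasure lborel ?C / ennreal (4 * pi / 3)"
    by (rule divide_right_mono_ennreal[OF main])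
  also have "\<dots> = emeasure sphere_measure (cap w t)"
    unfolding emeasure_sphere_measure[OF bcap] ball ..
  finally show ?thesis unfolding eS eA .
qed

section \<open>Lattice tiles\<close>

lemma matrix_vector_mult_2: "(Q *v v) $ i = Q$i$1 * v$1 + Q$i$2 * v$2" for Q :: "real^2^'m"
  by (simp add: matrix_vector_mult_def sum_2)

lemma mem_tile_iff:
  "v \<in> tile Q K p \<longleftrightarrow> (\<exists>u. (\<forall>i. 0 \<le> u$i \<and> u$i < 1) \<and> v = (1 / real K) *\<^sub>R (p + Q *v u))"
  by (auto simp: tile_def fundamental_domain_def)

text \<open>Two points of a tile differ by \<open>Q\<close> applied to a vector with entries of
  absolute value at most 1, scaled by \<open>1 / K\<close>; this gives the absolute row
  sums.\<close>

lemma tile_extent: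
  assumes x: "x \<in> tile Q K p" and y: "y \<in> tile Q K p"
  shows "\<bar>x$i - y$i\<bar> \<le> (\<bar>Q$i$1\<bar> + \<bar>Q$i$2\<bar>) / real K"
proof -
  obtain u where u: "\<And>j. 0 \<le> u$j \<and> u$j < 1" "x = (1 / real K) *\<^sub>R (p + Q *v u)"
    using x unfolding mem_tile_iff by blast
  obtain v where v: "\<And>j. 0 \<le> v$j \<and> v$j < 1" "y = (1 / real K) *\<^sub>R (p + Q *v v)"
    using y unfolding mem_tile_iff by blast
  have le: "\<bar>u$j - v$j\<bar> \<le> 1" for j
    using u(1)[of j] v(1)[of j] by linarith
  have "x$i - y$i = (Q$i$1 * (u$1 - v$1) + Q$i$2 * (u$2 - v$2)) / real K"
    unfolding u(2) v(2) by (simp add: matrix_vector_mult_2 add_divide_distrib diff_divide_distrib algebra_simps)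
  also have "\<bar>\<dots>\<bar> = \<bar>Q$i$1 * (u$1 - v$1) + Q$i$2 * (u$2 - v$2)\<bar> / real K"
    by simp
  also have "\<dots> \<le> (\<bar>Q$i$1\<bar> + \<bar>Q$i$2\<bar>) / real K"
  proof (rule divide_right_mono)
    have "\<bar>Q$i$1 * (u$1 - v$1)\<bar> \<le> \<bar>Q$i$1\<bar>" "\<bar>Q$i$2 * (u$2 - v$2)\<bar> \<le> \<bar>Q$i$2\<bar>"
      using le by (auto simp: abs_mult intro!: mult_left_le)
    then show "\<bar>Q$i$1 * (u$1 - v$1) + Q$i$2 * (u$2 - v$2)\<bar> \<le> \<bar>Q$i$1\<bar> + \<bar>Q$i$2\<bar>" by linarith
  qed simp
  finally show ?thesis .
qed

text \<open>In the coordinates given by the inverse of \<open>Q\<close>, scaled by \<open>K\<close>,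
  the integer parts select the lattice point and the fractional parts the position inside its
  tile.\<close>

lemma tiles_cover:
  assumes Q: "invertible Q" and K: "K \<ge> 1"
  obtains p where "p \<in> lattice Q" "v \<in> tile Q K p"
proof -
  obtain Q' where Q': "Q ** Q' = mat 1"
    using Q unfolding invertible_def by blast
  define s where "s = Q' *v (real K *\<^sub>R v)"
  define m :: "real^2" where "m = (\<chi> i. of_int \<lfloor>s$i\<rfloor>)"
  define u where "u = s - m"
  have "\<forall>i. m$i \<in> \<int>" by (simp add: m_def)
  then have "Q *v m \<in> lattice Q" unfolding lattice_def by blast
  moreover have "v \<in> tile Q K (Q *v m)"
    unfolding mem_tile_iff
  proof (intro exI conjI)
    show "\<forall>i. 0 \<le> u$i \<and> u$i < 1"
      unfolding u_def m_def by (auto simp: floor_le_iff) linarith+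
    have "Q *v m + Q *v u = Q *v s"
      by (simp add: matrix_vector_right_distrib[symmetric] u_def)
    also have "\<dots> = real K *\<^sub>R v"
      unfolding s_def by (simp add: matrix_vector_mul_assoc Q')
    finally show "v = (1 / real K) *\<^sub>R (Q *v m + Q *v u)"
      using K by simp
  qed
  ultimately show ?thesis by (rule that)
qed

text \<open>In the same coordinates this is uniqueness of integer parts: two integers that differ by
  less than 1 are equal.\<close>

lemma tiles_disjoint:
  assumes Q: "invertible Q" and K: "K \<ge> 1"
    and p: "p \<in> lattice Q" "p' \<in> lattice Q" and v: "v \<in> tile Q K p" "v \<in> tile Q K p'"
  shows "p = p'"
proof -
  obtain Q' where Q': "Q' ** Q = mat 1"
    using Q unfolding invertible_def by blast
  obtain m m' where m: "\<And>i. m$i \<in> \<int>" "p = Q *v m" "\<And>i. m'$i \<in> \<int>" "p' = Q *v m'"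
    using p unfolding lattice_def by blast
  obtain u where u: "\<And>j. 0 \<le> u$j \<and> u$j < 1" "v = (1 / real K) *\<^sub>R (p + Q *v u)"
    using v(1) unfolding mem_tile_iff by blast
  obtain u' where u': "\<And>j. 0 \<le> u'$j \<and> u'$j < 1" "v = (1 / real K) *\<^sub>R (p' + Q *v u')"
    using v(2) unfolding mem_tile_iff by blast
  have "(1 / real K) *\<^sub>R (p + Q *v u) = (1 / real K) *\<^sub>R (p' + Q *v u')"
    unfolding u(2)[symmetric] by (rule u'(2))
  then have "p + Q *v u = p' + Q *v u'" using K by (metis One_nat_def divide_eq_0_iff not_one_le_zero of_nat_eq_0_iff scaleR_cancel_left zero_neq_one)
  then have "Q *v (m + u) = Q *v (m' + u')"
    unfolding m by (simp add: matrix_vector_right_distrib)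
  then have "Q' *v (Q *v (m + u)) = Q' *v (Q *v (m' + u'))" by simp
  then have eq: "m + u = m' + u'" by (simp add: matrix_vector_mul_assoc Q')
  have "m$i = m'$i" for i
  proof -
    have "m$i - m'$i = u'$i - u$i"
      using arg_cong[OF eq, of "\<lambda>x. x$i"] by simp
    moreover obtain k where "m$i - m'$i = of_int k"
      using m(1,3)[of i] by (metis Ints_cases Ints_diff)
    ultimately have "\<bar>real_of_int k\<bar> < 1" using u(1)[of i] u'(1)[of i] by linarith
    then have "k = 0" by linarith
    then show ?thesis using \<open>m$i - m'$i = of_int k\<close> by simp
  qed
  then have "m = m'" by (simp add: vec_eq_iff)
  then show ?thesis unfolding m by simp
qed

lemma measure_tile:
  shows "tile Q K p \<in> lmeasurable" "measure lebesgue (tile Q K p) = \<bar>det Q\<bar> / (real K)\<^sup>2"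
proof -
  let ?B = "{v :: real^2. \<forall>i. 0 \<le> v$i \<and> v$i < 1}"
  \<comment> \<open>The half-open cube lies between the open and the closed unit cube, both of
    measure 1. A tile is a translate of its linear image.\<close>
  have B: "box 0 1 \<subseteq> ?B" "?B \<subseteq> cbox 0 1"
    by (auto simp: mem_box_cart less_imp_le)
  have Bb: "?B \<in> sets borel"
  proof -
    have [measurable]: "(\<lambda>v. v $ i) \<in> borel_measurable borel" for i :: 2
      by (intro borel_measurable_continuous_onI continuous_intros)
    show ?thesis unfolding forall_2 by measurable
  qed
  have Bl: "?B \<in> lmeasurable"
    using B(2) Bb by (intro bounded_set_imp_lmeasurable) (auto intro: bounded_subset[OF bounded_cbox])
  have one: "measure lebesgue (box 0 (1::real^2)) = 1" "measure lebesgue (cbox 0 (1::real^2)) = 1"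
  proof -
    have "measure lborel (box 0 (1::real^2)) = (\<Prod>b\<in>Basis. (1 - 0 :: real^2) \<bullet> b)"
      by (intro measure_lborel_box) (auto simp: Basis_vec_def inner_axis)
    then show "measure lebesgue (box 0 (1::real^2)) = 1" by (simp add: prod_Basis_vec)
    show "measure lebesgue (cbox 0 (1::real^2)) = 1"
      by (simp add: content_cbox_cart interval_eq_empty_cart)
  qed
  have mB: "measure lebesgue ?B = 1"
  proof (rule antisym)
    show "measure lebesgue ?B \<le> 1"
      using measure_mono_fmeasurable[OF B(2), of lebesgue] Bb one by simp
    show "1 \<le> measure lebesgue ?B"
      using measure_mono_fmeasurable[OF B(1) _ Bl] one by simp
  qed
  define A where "A = (1 / real K) *\<^sub>R Q"
  have t: "tile Q K p = (+) ((1 / real K) *\<^sub>R p) ` ((*v) A ` ?B)"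
    unfolding tile_def fundamental_domain_def image_image A_def
    by (intro image_cong refl) (simp add: vec_eq_iff matrix_vector_mult_2 algebra_simps)
  have d: "det A = det Q / (real K)\<^sup>2"
    by (simp add: A_def det_2 power2_eq_square diff_divide_distrib)
  have l: "linear ((*v) A)" by (rule matrix_vector_mul_linear)
  show "tile Q K p \<in> lmeasurable"
    unfolding t by (intro measurable_translation measurable_linear_image l Bl)
  show "measure lebesgue (tile Q K p) = \<bar>det Q\<bar> / (real K)\<^sup>2"
    unfolding t measure_translation measure_linear_image[OF l Bl] mB by (simp add: d)
qed

text \<open>A packing bound: disjoint tiles inside \<open>D\<close> have total area at most that of
  \<open>D\<close>. The bound is uniform over finite subfamilies, which also forces \<open>F\<close>
  to be finite.\<close>

lemma card_tiles_le:
  assumes Q: "invertible Q" and K: "K \<ge> 1" and F: "F \<subseteq> lattice Q"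
    and D: "\<And>p. p \<in> F \<Longrightarrow> tile Q K p \<subseteq> D" "D \<in> lmeasurable"
  shows "finite F" "real (card F) * (\<bar>det Q\<bar> / (real K)\<^sup>2) \<le> measure lebesgue D"
proof -
  let ?\<mu> = "\<bar>det Q\<bar> / (real K)\<^sup>2"
  have \<mu>: "0 < ?\<mu>" using Q K by (simp add: invertible_det_nz)
  have le: "real (card G) * ?\<mu> \<le> measure lebesgue D" if G: "G \<subseteq> F" "finite G" for G
  proof -
    have dis: "disjoint_family_on (tile Q K) G"
      unfolding disjoint_family_on_def using tiles_disjoint[OF Q K] G F by blast
    have "real (card G) * ?\<mu> = (\<Sum>p\<in>G. measure lebesgue (tile Q K p))"
      by (simp add: measure_tile)
    also have "\<dots> = measure lebesgue (\<Union>p\<in>G. tile Q K p)"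
      using G(2) dis measure_tile(1)[of Q K]
      by (intro measure_finite_Union[symmetric]) (auto simp: fmeasurableD fmeasurableD2 simp del: emeasure_completion)
    also have "\<dots> \<le> measure lebesgue D"
      using G D measure_tile(1)[of Q K] by (intro measure_mono_fmeasurable) (auto intro!: sets.finite_UN)
    finally show ?thesis .
  qed
  have "finite F \<and> card F \<le> nat \<lfloor>measure lebesgue D / ?\<mu>\<rfloor>"
  proof (rule finite_if_finite_subsets_card_bdd)
    fix G assume "G \<subseteq> F" "finite G"
    then have "real (card G) \<le> measure lebesgue D / ?\<mu>"
      using le[of G] by (subst pos_le_divide_eq[OF \<mu>])
    then show "card G \<le> nat \<lfloor>measure lebesgue D / ?\<mu>\<rfloor>"
      by (simp add: le_nat_iff le_floor_iff)
  qed
  then show "finite F" by blast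
  then show "real (card F) * ?\<mu> \<le> measure lebesgue D" by (intro le) auto
qed

text \<open>The covering counterpart, by subadditivity of area.\<close>

lemma card_tiles_ge:
  assumes F: "finite F" and D: "D \<subseteq> (\<Union>p\<in>F. tile Q K p)" "D \<in> lmeasurable"
  shows "measure lebesgue D \<le> real (card F) * (\<bar>det Q\<bar> / (real K)\<^sup>2)"
proof -
  have "measure lebesgue D \<le> measure lebesgue (\<Union>p\<in>F. tile Q K p)"
    using D F measure_tile(1)[of Q K] by (intro measure_mono_fmeasurable) (auto intro!: fmeasurable.finite_UN)
  also have "\<dots> \<le> (\<Sum>p\<in>F. measure lebesgue (tile Q K p))"
    using F measure_tile(1)[of Q K] by (intro measure_UNION_le) auto
  finally show ?thesis by (simp add: measure_tile)
qed

lemma emeasure_vec2_vimage: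
  assumes "A \<in> sets borel"
  shows "emeasure lborel {v :: real^2. (v$1, v$2) \<in> A} = emeasure lborel A"
    and "{v :: real^2. (v$1, v$2) \<in> A} \<in> sets borel"
proof -
  have m: "(\<lambda>v :: real^2. (v$1, v$2)) \<in> borel_measurable borel"
    by (intro borel_measurable_continuous_onI continuous_intros)
  then show s: "{v :: real^2. (v$1, v$2) \<in> A} \<in> sets borel"
    using measurable_sets[OF m assms] by (simp add: vimage_def)
  have "vec2 -` {v. (v$1, v$2) \<in> A} = A" by auto
  then show "emeasure lborel {v :: real^2. (v$1, v$2) \<in> A} = emeasure lborel A"
    using s by (subst lborel_vec2, subst emeasure_distr) auto
qed

section \<open>Counting sample points in the square and in caps\<close>

context
  fixes Q :: "real^2^2" and K :: nat and z :: "real^2 \<Rightarrow> real^2"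
  assumes Q: "invertible Q" and K: "K \<ge> 1" and z: "\<And>p. p \<in> lattice Q \<Longrightarrow> z p \<in> tile Q K p"
begin

abbreviation "tile_width \<equiv> (\<bar>Q$1$1\<bar> + \<bar>Q$1$2\<bar>) / real K"
abbreviation "tile_height \<equiv> (\<bar>Q$2$1\<bar> + \<bar>Q$2$2\<bar>) / real K"
abbreviation "tile_area \<equiv> \<bar>det Q\<bar> / (real K)\<^sup>2"

lemma inj_on_sample: "inj_on z (lattice Q)"
  using tiles_disjoint[OF Q K] z by (metis inj_onI)

text \<open>For finiteness, tiles with a sample point in the square stay in a bounded box. For the
  lower bound, the square shrunk by one tile size on every side is covered by such tiles.\<close>

lemma finite_perturbed_lattice_points: "finite (perturbed_lattice_points Q z)"
  and card_perturbed_lattice_points_ge: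
    "1 - 2 * tile_width - 2 * tile_height \<le> real (card (perturbed_lattice_points Q z)) * tile_area"
proof -
  let ?a = "tile_width" and ?b = "tile_height"
  define F where "F = {p \<in> lattice Q. z p \<in> unit_square}"
  have P: "perturbed_lattice_points Q z = z ` F"
    by (auto simp: perturbed_lattice_points_def F_def)
  have F: "F \<subseteq> lattice Q" by (auto simp: F_def)
  have near: "\<bar>v$1 - z p$1\<bar> \<le> ?a" "\<bar>v$2 - z p$2\<bar> \<le> ?b" if "p \<in> lattice Q" "v \<in> tile Q K p" for p v
    using tile_extent[OF that(2) z[OF that(1)]] by auto
  \<comment> \<open>The margin \<open>?a + ?b\<close> is generous in both directions; only
    boundedness matters here.\<close>
  let ?D = "cbox (\<chi> i. - (?a + ?b)) (\<chi> i. 1 + (?a + ?b)) :: (real^2) set"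
  have ab: "0 \<le> ?a" "0 \<le> ?b" by auto
  have finF: "finite F"
  proof (rule card_tiles_le(1)[OF Q K F])
    fix p assume p: "p \<in> F"
    show "tile Q K p \<subseteq> ?D"
    proof
      fix v assume "v \<in> tile Q K p"
      moreover have "p \<in> lattice Q" "z p \<in> unit_square" using p by (auto simp: F_def)
      ultimately show "v \<in> ?D"
        using near[of p v] ab unfolding mem_box_cart forall_2 unit_square_def mem_Collect_eq vec_lambda_beta
        by linarith
    qed
  qed simp
  then show "finite (perturbed_lattice_points Q z)" unfolding P by simp
  have card: "card (perturbed_lattice_points Q z) = card F"
    unfolding P by (intro card_image inj_on_subset[OF inj_on_sample F])
  show "1 - 2 * ?a - 2 * ?b \<le> real (card (perturbed_lattice_points Q z)) * tile_area"
  proof (cases "?a \<le> 1 / 2 \<and> ?b \<le> 1 / 2")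
    case False
    then have "1 - 2 * ?a - 2 * ?b \<le> 0" using ab by linarith
    also have "0 \<le> real (card (perturbed_lattice_points Q z)) * tile_area" by simp
    finally show ?thesis .
  next
    case True
    let ?E = "box (vec2 (?a, ?b)) (vec2 (1 - ?a, 1 - ?b))"
    have "1 - 2 * ?a - 2 * ?b \<le> (1 - 2 * ?a) * (1 - 2 * ?b)"
      using mult_nonneg_nonneg[OF ab] by (simp only: algebra_simps)
    also have "\<dots> = (\<Prod>b\<in>Basis. (vec2 (1 - ?a, 1 - ?b) - vec2 (?a, ?b)) \<bullet> b)"
    proof -
      have "(\<Prod>i\<in>UNIV. (vec2 (1 - x, 1 - y) - vec2 (x, y)) $ i) = (1 - 2 * x) * (1 - 2 * y)" for x y
        by (simp add: UNIV_2 algebra_simps)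
      then show ?thesis unfolding prod_Basis_vec by simp
    qed
    also have "\<dots> = measure lborel ?E"
    proof (rule measure_lborel_box[symmetric])
      have "vec2 (?a, ?b) $ i \<le> vec2 (1 - ?a, 1 - ?b) $ i" for i
      proof -
        have "x \<le> 1 - x" if "x \<le> 1 / 2" for x :: real using that by simp
        then show ?thesis
          using True exhaust_2[of i] by (elim disjE) (simp_all only: vec2_nth fst_conv snd_conv)
      qed
      then show "vec2 (?a, ?b) \<bullet> b \<le> vec2 (1 - ?a, 1 - ?b) \<bullet> b" if "b \<in> Basis" for b
        using that by (auto simp: Basis_vec_def inner_axis)
    qed
    also have "\<dots> = measure lebesgue ?E" by simp
    also have "\<dots> \<le> real (card F) * tile_area"
    proof (rule card_tiles_ge[OF finF])
      show "?E \<subseteq> (\<Union>p\<in>F. tile Q K p)"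
      proof
        fix v assume v: "v \<in> ?E"
        \<comment> \<open>The sample point of the tile through \<open>v\<close> is within one tile
          size of \<open>v\<close>, hence still inside the square.\<close>
        obtain p where p: "p \<in> lattice Q" "v \<in> tile Q K p"
          using tiles_cover[OF Q K] .
        have "z p \<in> unit_square"
          using near[OF p] v unfolding mem_box_cart forall_2 unit_square_def mem_Collect_eq vec2_nth fst_conv snd_conv
          by linarith
        then show "v \<in> (\<Union>p\<in>F. tile Q K p)" using p by (auto simp: F_def)
      qed
    qed simp
    finally show ?thesis unfolding card .
  qed
qed

text \<open>A tile whose sample point lies in the flat cap is contained in the flat cap thickened by
  one tile size, so the packing bound applies to the thickened cap.\<close>

lemma card_cap_le:
  "real (card {v \<in> perturbed_lattice_points Q z. lambert v \<in> cap w t}) * tile_area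
     \<le> measure sphere_measure (cap w t) + (4 * tile_width + 4 * tile_height * (1 + 2 * tile_width))"
proof -
  let ?a = "tile_width" and ?b = "tile_height"
  let ?e = "4 * ?a + 4 * ?b * (1 + 2 * ?a)"
  define F where "F = {p \<in> lattice Q. z p \<in> unit_square \<and> lambert (z p) \<in> cap w t}"
  have P: "{v \<in> perturbed_lattice_points Q z. lambert v \<in> cap w t} = z ` F"
    by (auto simp: perturbed_lattice_points_def F_def)
  have F: "F \<subseteq> lattice Q" by (auto simp: F_def)
  have ab: "0 \<le> ?a" "0 \<le> ?b" by auto
  have e: "0 \<le> ?e" using ab by (intro add_nonneg_nonneg mult_nonneg_nonneg) auto
  let ?T = "box_thicken ?a ?b (flat_cap w t)"
  let ?D = "{v :: real^2. (v$1, v$2) \<in> ?T}"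
  have T: "?T \<in> sets borel"
    by (intro borel_compact compact_box_thicken compact_flat_cap)
  note D = emeasure_vec2_vimage[OF T]
  interpret sphere: prob_space sphere_measure by (rule prob_space_sphere_measure)
  have "emeasure lborel ?D \<le> emeasure lborel (flat_cap w t) + ennreal ?e"
    unfolding D(1) by (rule emeasure_box_thicken_flat_cap[OF ab])
  also have "\<dots> \<le> emeasure sphere_measure (cap w t) + ennreal ?e"
    by (intro add_right_mono sphere_measure_cap_ge)
  also have "\<dots> = ennreal (measure sphere_measure (cap w t) + ?e)"
    using e by (simp add: sphere.emeasure_eq_measure)
  finally have le: "emeasure lborel ?D \<le> ennreal (measure sphere_measure (cap w t) + ?e)" .
  have "?D \<in> lmeasurable"
    using D(2) le_less_trans[OF le ennreal_less_top] by (intro fmeasurableI) auto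
  have "real (card F) * tile_area \<le> measure lebesgue ?D"
  proof (rule card_tiles_le(2)[OF Q K F])
    fix p assume p: "p \<in> F"
    show "tile Q K p \<subseteq> ?D"
    proof
      fix v assume v: "v \<in> tile Q K p"
      have p': "p \<in> lattice Q" "z p \<in> unit_square" "lambert (z p) \<in> cap w t"
        using p by (auto simp: F_def)
      then have "(z p$1, z p$2) \<in> flat_cap w t"
        by (auto simp: flat_cap_def cap_def inner_lambert unit_square_def)
      moreover have "\<bar>v$1 - z p$1\<bar> \<le> ?a" "\<bar>v$2 - z p$2\<bar> \<le> ?b"
        using tile_extent[OF v z[OF p'(1)]] by auto
      ultimately show "v \<in> ?D" by (force simp: box_thicken_def)
    qed
  qed fact
  also have "\<dots> = measure lborel ?D" using D(2) by simp
  also have "\<dots> \<le> measure sphere_measure (cap w t) + ?e"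
    using le e by (simp add: measure_def enn2real_leI)
  finally show ?thesis
    unfolding P by (simp add: card_image inj_on_subset[OF inj_on_sample F])
qed

text \<open>The coefficient 6 is 4 from thickening the cap plus 2 from comparing
  \<open>N * tile_area\<close> with 1. The product term comes from the corners of the
  thickening.\<close>

lemma cap_count_deviation:
  fixes w t
  defines "n \<equiv> real (card {v \<in> perturbed_lattice_points Q z. lambert v \<in> cap w t})"
    and "N \<equiv> real (card (perturbed_lattice_points Q z))"
    and "\<sigma> \<equiv> measure sphere_measure (cap w t)"
  shows "\<bar>n - N * \<sigma>\<bar> * tile_area \<le> 6 * tile_width + 6 * tile_height + 8 * tile_width * tile_height"
proof -
  let ?a = "tile_width" and ?b = "tile_height" and ?P = "perturbed_lattice_points Q z"
  let ?e = "4 * ?a + 4 * ?b * (1 + 2 * ?a)"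
  interpret sphere: prob_space sphere_measure by (rule prob_space_sphere_measure)
  have s: "0 \<le> \<sigma>" "\<sigma> \<le> 1" by (simp_all add: \<sigma>_def)
  have ab: "0 \<le> ?a" "0 \<le> ?b" by auto
  have N: "1 - 2 * ?a - 2 * ?b \<le> N * tile_area"
    unfolding N_def by (rule card_perturbed_lattice_points_ge)
  have n: "n * tile_area \<le> \<sigma> + ?e"
    unfolding n_def \<sigma>_def by (rule card_cap_le)
  have n': "(N - n) * tile_area \<le> 1 - \<sigma> + ?e"
  proof -
    let ?R = "{v \<in> ?P. lambert v \<notin> cap w t}"
    have fin: "finite ?P" by (rule finite_perturbed_lattice_points)
    \<comment> \<open>The complement of a closed cap is an open cap, but \<open>?R\<close> is
      finite, so a slightly smaller closed cap around \<open>- w\<close> contains the images of all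
      its points. The strict inequality keeps the two closed caps disjoint.\<close>
    have "\<exists>t'>-t. \<forall>v\<in>?R. t' \<le> - w \<bullet> lambert v"
    proof (cases "?R = {}")
      case True
      then show ?thesis using gt_ex[of "- t"] by (metis empty_iff)
    next
      case False
      let ?m = "Min ((\<lambda>v. - w \<bullet> lambert v) ` ?R)"
      have "?m \<in> (\<lambda>v. - w \<bullet> lambert v) ` ?R"
        using False fin by (intro Min_in) auto
      then have "- t < ?m"
        by (auto simp: cap_def norm_lambert perturbed_lattice_points_def)
      moreover have "?m \<le> - w \<bullet> lambert v" if "v \<in> ?R" for v
        using that fin by (intro Min_le) auto
      ultimately show ?thesis by blast
    qed
    then obtain t' where t': "- t < t'" "\<And>v. v \<in> ?R \<Longrightarrow> t' \<le> - w \<bullet> lambert v" by blast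
    have "?R \<subseteq> {v \<in> ?P. lambert v \<in> cap (- w) t'}"
      using t'(2) by (auto simp: cap_def norm_lambert perturbed_lattice_points_def)
    then have "card ?R \<le> card {v \<in> ?P. lambert v \<in> cap (- w) t'}"
      using fin by (intro card_mono) auto
    moreover have "N - n = real (card ?R)"
    proof -
      have "card ?P = card ({v \<in> ?P. lambert v \<in> cap w t} \<union> ?R)"
        by (intro arg_cong[of _ _ card]) auto
      also have "\<dots> = card {v \<in> ?P. lambert v \<in> cap w t} + card ?R"
        using fin by (intro card_Un_disjoint) auto
      finally show ?thesis by (simp add: N_def n_def)
    qed
    ultimately have "(N - n) * tile_area \<le> real (card {v \<in> ?P. lambert v \<in> cap (- w) t'}) * tile_area"
      by (intro mult_right_mono) auto
    also have "\<dots> \<le> measure sphere_measure (cap (- w) t') + ?e" by (rule card_cap_le)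
    also have "measure sphere_measure (cap (- w) t') \<le> 1 - \<sigma>"
    proof -
      have "cap (- w) t' \<inter> cap w t = {}" using t'(1) by (auto simp: cap_def)
      then have "measure sphere_measure (cap (- w) t') + \<sigma> = measure sphere_measure (cap (- w) t' \<union> cap w t)"
        unfolding \<sigma>_def using borel_cap by (intro sphere.finite_measure_Union[symmetric]) auto
      also have "\<dots> \<le> 1" by simp
      finally show ?thesis by simp
    qed
    finally show ?thesis by simp
  qed
  have "4 * x + 4 * y * (1 + 2 * x) = 4 * x + 4 * y + 8 * (x * y)" for x y :: real
    by (simp add: algebra_simps)
  then have e: "?e = 4 * ?a + 4 * ?b + 8 * (?a * ?b)" .
  \<comment> \<open>Both directions of the estimate use only the lower bound on
    \<open>N * tile_area\<close>, since the weights \<open>\<sigma>\<close> and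
    \<open>1 - \<sigma>\<close> are nonnegative.\<close>
  have x: "\<sigma> * (1 - N * tile_area) \<le> 2 * ?a + 2 * ?b" "(1 - \<sigma>) * (1 - N * tile_area) \<le> 2 * ?a + 2 * ?b"
  proof -
    have *: "r * (1 - N * tile_area) \<le> 2 * ?a + 2 * ?b" if "0 \<le> r" "r \<le> 1" for r
    proof -
      have "r * (1 - N * tile_area) \<le> r * (2 * ?a + 2 * ?b)"
        using that N by (intro mult_left_mono) auto
      also have "\<dots> \<le> 1 * (2 * ?a + 2 * ?b)"
        using that ab by (intro mult_right_mono) auto
      finally show ?thesis by simp
    qed
    show "\<sigma> * (1 - N * tile_area) \<le> 2 * ?a + 2 * ?b" "(1 - \<sigma>) * (1 - N * tile_area) \<le> 2 * ?a + 2 * ?b"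
      by (rule *; use s in linarith)+
  qed
  \<comment> \<open>The deviation splits into the error of the cap count against
    \<open>\<sigma>\<close> and the weighted error of the total count against 1.\<close>
  have "(n - N * \<sigma>) * x = n * x - \<sigma> + \<sigma> * (1 - N * x)" for x
    by (simp add: algebra_simps)
  from this[of tile_area] have 1: "(n - N * \<sigma>) * tile_area \<le> 6 * ?a + 6 * ?b + 8 * (?a * ?b)"
    using n x(1) e by linarith
  have "- ((n - N * \<sigma>) * x) = (N - n) * x - (1 - \<sigma>) + (1 - \<sigma>) * (1 - N * x)" for x
    by (simp add: algebra_simps)
  from this[of tile_area] have 2: "- ((n - N * \<sigma>) * tile_area) \<le> 6 * ?a + 6 * ?b + 8 * (?a * ?b)"
    using n' x(2) e by linarith
  have "\<bar>n - N * \<sigma>\<bar> * tile_area = \<bar>(n - N * \<sigma>) * tile_area\<bar>"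
    by (simp add: abs_mult)
  also have "\<dots> \<le> 6 * ?a + 6 * ?b + 8 * (?a * ?b)"
    using 1 2 by linarith
  finally show ?thesis by (simp only: mult.assoc)
qed

end

section \<open>The discrepancy bound\<close>

lemma sum_abs_entries_le_frobenius:
  "\<bar>Q$1$1\<bar> + \<bar>Q$1$2\<bar> + (\<bar>Q$2$1\<bar> + \<bar>Q$2$2\<bar>) \<le> 2 * frobenius_norm Q"
proof -
  let ?p = "\<bar>Q$1$1\<bar>" and ?q = "\<bar>Q$1$2\<bar>" and ?r = "\<bar>Q$2$1\<bar>" and ?s = "\<bar>Q$2$2\<bar>"
  have f: "frobenius_norm Q = sqrt (?p\<^sup>2 + ?q\<^sup>2 + ?r\<^sup>2 + ?s\<^sup>2)"
    unfolding frobenius_norm_def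
    by (simp add: trace_def matrix_matrix_mult_def transpose_def sum_2 power2_eq_square)
  \<comment> \<open>Lagrange's identity for the Cauchy-Schwarz inequality with the all-ones vector:
    the defect is a sum of six squares.\<close>
  have "(?p + ?q + (?r + ?s))\<^sup>2 + ((?p - ?q)\<^sup>2 + (?p - ?r)\<^sup>2 + (?p - ?s)\<^sup>2 + (?q - ?r)\<^sup>2 + (?q - ?s)\<^sup>2 + (?r - ?s)\<^sup>2)
      = 4 * (?p\<^sup>2 + ?q\<^sup>2 + ?r\<^sup>2 + ?s\<^sup>2)"
    by algebra
  moreover have "0 \<le> (?p - ?q)\<^sup>2 + (?p - ?r)\<^sup>2 + (?p - ?s)\<^sup>2 + (?q - ?r)\<^sup>2 + (?q - ?s)\<^sup>2 + (?r - ?s)\<^sup>2"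
    by (intro add_nonneg_nonneg zero_le_power2)
  ultimately have "(?p + ?q + (?r + ?s))\<^sup>2 \<le> 4 * (?p\<^sup>2 + ?q\<^sup>2 + ?r\<^sup>2 + ?s\<^sup>2)" by linarith
  then have "?p + ?q + (?r + ?s) \<le> sqrt (4 * (?p\<^sup>2 + ?q\<^sup>2 + ?r\<^sup>2 + ?s\<^sup>2))"
    by (rule real_le_rsqrt)
  also have "\<dots> = 2 * sqrt (?p\<^sup>2 + ?q\<^sup>2 + ?r\<^sup>2 + ?s\<^sup>2)"
    unfolding real_sqrt_mult by simp
  finally show ?thesis unfolding f .
qed

text \<open>Injectivity of the Lambert map preserves cardinalities, so counts on the sphere become
  counts in the square, and a bound uniform in the cap passes to both suprema.\<close>

lemma cap_discrepancy_lambert: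
  assumes P: "P \<subseteq> unit_square" "finite P"
    and B: "\<And>w t. \<bar>real (card {v \<in> P. lambert v \<in> cap w t}) / real (card P) - measure sphere_measure (cap w t)\<bar> \<le> B"
  shows "cap_discrepancy (lambert ` P) \<le> B"
proof -
  have inj: "inj_on lambert P" using inj_on_subset[OF inj_on_lambert P(1)] .
  have "(\<Sum>p\<in>lambert ` P. indicator (cap w t) p) = real (card {v \<in> P. lambert v \<in> cap w t})" for w t
  proof -
    have "(\<Sum>p\<in>lambert ` P. indicator (cap w t) p) = (\<Sum>v\<in>P. indicator {v. lambert v \<in> cap w t} v :: real)"
      unfolding sum.reindex[OF inj] by (intro sum.cong) (auto simp: indicator_def)
    also have "\<dots> = real (card (P \<inter> {v. lambert v \<in> cap w t}))"
      using P(2) by (simp add: indicator_def sum.If_cases)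
    finally show ?thesis by (simp add: Int_def)
  qed
  then have "\<bar>1 / real (card (lambert ` P)) * (\<Sum>p\<in>lambert ` P. indicator (cap w t) p)
      - measure sphere_measure (cap w t)\<bar> \<le> B" for w t
    using B[of w t] by (simp add: card_image[OF inj])
  moreover have "sphere (0 :: real^3) 1 \<noteq> {}"
    using norm_axis_1[of 1] by (metis dist_0_norm empty_iff mem_sphere)
  ultimately show ?thesis
    unfolding cap_discrepancy_def by (intro cSUP_least) auto
qed

theorem corollary1:
  fixes Q :: "real^2^2"
  assumes "invertible Q"
  shows "\<exists>C::real. \<forall>(K::nat) (z :: real^2 \<Rightarrow> real^2).
    K \<ge> 1 \<longrightarrow> (\<forall>p \<in> lattice Q. z p \<in> tile Q K p) \<longrightarrow>
    perturbed_lattice_points Q z \<noteq> {} \<longrightarrow>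
    (let N = real (card (perturbed_lattice_points Q z)) in
      cap_discrepancy (lambert ` perturbed_lattice_points Q z)
        \<le> frobenius_norm Q / sqrt \<bar>det Q\<bar> * ((8 + 3 * sqrt 2) / sqrt N) + C / N)"
proof -
  define d where "d = \<bar>det Q\<bar>"
  define a where "a = \<bar>Q$1$1\<bar> + \<bar>Q$1$2\<bar>"
  define b where "b = \<bar>Q$2$1\<bar> + \<bar>Q$2$2\<bar>"
  define F where "F = frobenius_norm Q"
  have d: "0 < d" using assms by (simp add: d_def invertible_det_nz)
  have ab: "0 \<le> a" "0 \<le> b" by (auto simp: a_def b_def)
  have abF: "a + b \<le> 2 * F"
    using sum_abs_entries_le_frobenius[of Q] by (simp add: a_def b_def F_def)
  have F: "0 \<le> F" using abF ab by linarith
  \<comment> \<open>\<open>c\<close> bounds the excess of \<open>K\<close> over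
    \<open>sqrt (d * N)\<close>. \<open>C\<close> collects the terms without growth in
    \<open>N\<close>: one from this excess, one from the product of the tile sides. Both depend on
    \<open>Q\<close> alone.\<close>
  define c where "c = 2 * (a + b)"
  define C where "C = (12 * F * c + 8 * a * b) / d"
  have "cap_discrepancy (lambert ` P) \<le> F / sqrt d * ((8 + 3 * sqrt 2) / sqrt N) + C / N"
    if K: "K \<ge> 1" and z: "\<forall>p \<in> lattice Q. z p \<in> tile Q K p" and ne: "P \<noteq> {}"
      and P: "P = perturbed_lattice_points Q z" and N: "N = real (card P)"
    for K :: nat and z P N
  proof -
    define k where "k = real K"
    have k: "0 < k" using K by (simp add: k_def)
    have finP: "finite P"
      unfolding P using finite_perturbed_lattice_points[OF assms K] z by blast
    have N0: "0 < N" using ne finP by (simp add: N card_gt_0_iff)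
    have kN: "k \<le> sqrt (d * N) + c"
    proof -
      have "1 - 2 * (a / k) - 2 * (b / k) \<le> N * (d / k\<^sup>2)"
        using card_perturbed_lattice_points_ge[OF assms K, of z] z by (simp add: P N a_def b_def d_def k_def)
      then have "(1 - 2 * (a / k) - 2 * (b / k)) * k\<^sup>2 \<le> N * (d / k\<^sup>2) * k\<^sup>2"
        by (intro mult_right_mono) auto
      moreover have "(1 - 2 * (a / k) - 2 * (b / k)) * k\<^sup>2 = k * k - c * k"
        using k by (simp add: c_def power2_eq_square field_simps)
      \<comment> \<open>This quadratic inequality is solved for \<open>k\<close>: beyond
        \<open>c\<close>, the square of \<open>k - c\<close> is at most
        \<open>k * k - c * k\<close>.\<close>
      ultimately have q: "k * k - c * k \<le> d * N"
        using k by (simp add: mult.commute)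
      show ?thesis
      proof (cases "k \<le> c")
        case True
        then show ?thesis using d N0 by (simp add: add_increasing)
      next
        case False
        have c: "0 \<le> c" using ab by (simp add: c_def)
        have "(k - c)\<^sup>2 = (k * k - c * k) - c * (k - c)" by (simp add: power2_eq_square algebra_simps)
        also have "\<dots> \<le> d * N" using q c False mult_nonneg_nonneg[of c "k - c"] by linarith
        finally have "k - c \<le> sqrt (d * N)" by (rule real_le_rsqrt)
        then show ?thesis by simp
      qed
    qed
    show ?thesis
    proof (rule cap_discrepancy_lambert)
      show "P \<subseteq> unit_square" by (auto simp: P perturbed_lattice_points_def)
      show "finite P" by fact
      fix w t
      define n where "n = real (card {v \<in> P. lambert v \<in> cap w t})"
      define \<sigma> where "\<sigma> = measure sphere_measure (cap w t)"
      have "\<bar>n - N * \<sigma>\<bar> * (d / k\<^sup>2) \<le> 6 * (a / k) + 6 * (b / k) + 8 * (a / k) * (b / k)"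
        using cap_count_deviation[OF assms K, of z w t] z
        by (simp add: P N n_def \<sigma>_def a_def b_def d_def k_def)
      \<comment> \<open>Dividing by the tile area leaves a main term linear in \<open>k\<close>,
        which is of order \<open>sqrt N\<close>, and a bounded remainder.\<close>
      then have "\<bar>n - N * \<sigma>\<bar> * (d / k\<^sup>2) * (k\<^sup>2 / d) \<le> (6 * (a / k) + 6 * (b / k) + 8 * (a / k) * (b / k)) * (k\<^sup>2 / d)"
        using d by (intro mult_right_mono) auto
      also have "\<bar>n - N * \<sigma>\<bar> * (d / k\<^sup>2) * (k\<^sup>2 / d) = \<bar>n - N * \<sigma>\<bar>"
        using d k by simp
      also have "(6 * (a / k) + 6 * (b / k) + 8 * (a / k) * (b / k)) * (k\<^sup>2 / d) = (6 * (a + b) * k + 8 * a * b) / d"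
        using k d by (simp add: power2_eq_square field_simps)
      also have "\<dots> \<le> (12 * F * (sqrt (d * N) + c) + 8 * a * b) / d"
      proof (intro divide_right_mono add_right_mono)
        have "6 * (a + b) * k \<le> 12 * F * k" using abF k by (intro mult_right_mono) auto
        also have "\<dots> \<le> 12 * F * (sqrt (d * N) + c)" using kN F by (intro mult_left_mono) auto
        finally show "6 * (a + b) * k \<le> 12 * F * (sqrt (d * N) + c)" .
      qed (use d in simp)
      also have "\<dots> = 12 * F * sqrt (d * N) / d + C"
        unfolding C_def by (simp add: add_divide_distrib algebra_simps)
      finally have dev: "\<bar>n - N * \<sigma>\<bar> \<le> 12 * F * sqrt (d * N) / d + C" .
      have "\<bar>n / N - \<sigma>\<bar> = \<bar>n - N * \<sigma>\<bar> / N"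
      proof -
        have "n / N - \<sigma> = (n - N * \<sigma>) / N" using N0 by (simp add: field_simps)
        then show ?thesis using N0 by simp
      qed
      also have "\<dots> \<le> (12 * F * sqrt (d * N) / d + C) / N"
        using dev N0 by (intro divide_right_mono) auto
      also have "\<dots> = F / sqrt d * (12 / sqrt N) + C / N"
      proof -
        have "12 * F * sqrt (d * N) / d / N = 12 * F * (sqrt (d * N) / (d * N))"
          by simp
        also have "sqrt (d * N) / (d * N) = 1 / sqrt (d * N)"
          using d N0 by (simp add: field_simps)
        finally have "12 * F * sqrt (d * N) / d / N = 12 * F * (1 / sqrt (d * N))" .
        then show ?thesis by (simp add: add_divide_distrib real_sqrt_mult)
      qed
      also have "\<dots> \<le> F / sqrt d * ((8 + 3 * sqrt 2) / sqrt N) + C / N"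
      proof -
        \<comment> \<open>This is equivalent to 12 being at most
          \<open>8 + 3 * sqrt 2\<close>.\<close>
        have "4 / 3 \<le> sqrt (2 :: real)" by (rule real_le_rsqrt) (simp add: power2_eq_square)
        then show ?thesis
          using F d N0 by (intro add_right_mono mult_left_mono divide_right_mono) auto
      qed
      finally show "\<bar>real (card {v \<in> P. lambert v \<in> cap w t}) / real (card P) - measure sphere_measure (cap w t)\<bar>
          \<le> F / sqrt d * ((8 + 3 * sqrt 2) / sqrt N) + C / N"
        by (simp add: n_def \<sigma>_def N)
    qed
  qed
  then show ?thesis unfolding Let_def F_def d_def by blast
qed

end
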